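(* Let $A,B\in\mathfrak{sl}(n,\mathbb{H})$ and consider the invariant control system $\dot g=Ag+uBg$ on $\mathrm{Sl}(n,\mathbb{H})$ with unrestricted controls $u\in\mathbb{R}$. The system is controllable if the following conditions are satisfied: (1) the pair $(A,B)$ generates $\mathfrak{sl}(n,\mathbb{H})$ as a (real) Lie algebra; (2) $B=\mathrm{diag}\{a_1+ib_1,\ldots,a_n+ib_n\}$ with $a_r,b_r\in\mathbb{R}$, $a_1>a_2\geq\cdots\geq a_{n-1}>a_n$, $b_1\neq 0\neq b_n$, and $b_1/b_n$ irrational; (3) denoting by $p\in\mathbb{H}$ and $q\in\mathbb{H}$ the $(1,n)$ and $(n,1)$ entries of $A$, respectively, neither $p$ nor $q$ belongs to $\mathbb{H}_{1,i}\cup\mathbb{H}_{j,k}$, where $\mathbb{H}_{1,i}$ and $\mathbb{H}_{j,k}$ are the real subspaces of $\mathbb{H}$ spanned by $\{1,i\}$ and $\{j,k\}$, respectively.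
   Context: $\mathbb{H}$ denotes the real quaternions with standard basis $1,i,j,k$. $\mathrm{Sl}(n,\mathbb{H})$ is the Lie group of $n\times n$ quaternionic matrices $g$ with $|\det g|=1$ (equivalently, $g$ is invertible and the real-linear map it induces on $\mathbb{H}^n\cong\mathbb{R}^{4n}$ has determinant $1$). Its Lie algebra $\mathfrak{sl}(n,\mathbb{H})$ consists of the $n\times n$ quaternionic matrices whose trace has zero real part. The control semigroup $S_{A,B}$ of the system $\dot g=Ag+uBg$, $u\in\mathbb{R}$, is the subsemigroup of $\mathrm{Sl}(n,\mathbb{H})$ generated by all $e^{t(A+uB)}$ with $t\ge 0$ and $u\in\mathbb{R}$. The system is controllable if $S_{A,B}=\mathrm{Sl}(n,\mathbb{H})$. *)

theory Defs
  imports "HOL-Analysis.Analysis"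
begin

section \<open>The real quaternions\<close>

codatatype quat = Quat (qre: real) (qim1: real) (qim2: real) (qim3: real)

lemma quat_eq_iff:
  "x = y \<longleftrightarrow> qre x = qre y \<and> qim1 x = qim1 y \<and> qim2 x = qim2 y \<and> qim3 x = qim3 y"
  by (auto intro: quat.expand)

definition qi :: quat where "qi = Quat 0 1 0 0"
definition qj :: quat where "qj = Quat 0 0 1 0"
definition qk :: quat where "qk = Quat 0 0 0 1"

instantiation quat :: ab_group_add
begin

primcorec zero_quat where
  "qre 0 = 0" | "qim1 0 = 0" | "qim2 0 = 0" | "qim3 0 = 0"

primcorec plus_quat where
  "qre (x + y) = qre x + qre y"
| "qim1 (x + y) = qim1 x + qim1 y"
| "qim2 (x + y) = qim2 x + qim2 y"
| "qim3 (x + y) = qim3 x + qim3 y"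

primcorec uminus_quat where
  "qre (- x) = - qre x"
| "qim1 (- x) = - qim1 x"
| "qim2 (- x) = - qim2 x"
| "qim3 (- x) = - qim3 x"

primcorec minus_quat where
  "qre (x - y) = qre x - qre y"
| "qim1 (x - y) = qim1 x - qim1 y"
| "qim2 (x - y) = qim2 x - qim2 y"
| "qim3 (x - y) = qim3 x - qim3 y"

instance
  by standard (simp_all add: quat_eq_iff)

end

instantiation quat :: ring_1
begin

primcorec one_quat where
  "qre 1 = 1" | "qim1 1 = 0" | "qim2 1 = 0" | "qim3 1 = 0"

primcorec times_quat where
  "qre (x * y) = qre x * qre y - qim1 x * qim1 y - qim2 x * qim2 y - qim3 x * qim3 y"
| "qim1 (x * y) = qre x * qim1 y + qim1 x * qre y + qim2 x * qim3 y - qim3 x * qim2 y"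
| "qim2 (x * y) = qre x * qim2 y - qim1 x * qim3 y + qim2 x * qre y + qim3 x * qim1 y"
| "qim3 (x * y) = qre x * qim3 y + qim1 x * qim2 y - qim2 x * qim1 y + qim3 x * qre y"

instance
  by standard (simp_all add: quat_eq_iff algebra_simps)

end

lemma quat_units:
  "qi * qi = -1" "qj * qj = -1" "qk * qk = -1" "qi * qj * qk = -1"
  by (simp_all add: quat_eq_iff qi_def qj_def qk_def)

instantiation quat :: real_algebra_1
begin

primcorec scaleR_quat where
  "qre (r *\<^sub>R x) = r * qre x"
| "qim1 (r *\<^sub>R x) = r * qim1 x"
| "qim2 (r *\<^sub>R x) = r * qim2 x"
| "qim3 (r *\<^sub>R x) = r * qim3 x"

instance
  by standard (simp_all add: quat_eq_iff algebra_simps)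

end

instantiation quat :: real_div_algebra
begin

primcorec inverse_quat where
  "qre (inverse x) = qre x / ((qre x)\<^sup>2 + (qim1 x)\<^sup>2 + (qim2 x)\<^sup>2 + (qim3 x)\<^sup>2)"
| "qim1 (inverse x) = - qim1 x / ((qre x)\<^sup>2 + (qim1 x)\<^sup>2 + (qim2 x)\<^sup>2 + (qim3 x)\<^sup>2)"
| "qim2 (inverse x) = - qim2 x / ((qre x)\<^sup>2 + (qim1 x)\<^sup>2 + (qim2 x)\<^sup>2 + (qim3 x)\<^sup>2)"
| "qim3 (inverse x) = - qim3 x / ((qre x)\<^sup>2 + (qim1 x)\<^sup>2 + (qim2 x)\<^sup>2 + (qim3 x)\<^sup>2)"

definition "x div y = x * inverse y" for x y :: quat

instance
proof
  fix x y :: quat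
  show "x div y = x * inverse y"
    by (rule divide_quat_def)
  show "inverse 0 = (0 :: quat)"
    by (simp add: quat_eq_iff)
  assume "x \<noteq> 0"
  define N where "N = (qre x)\<^sup>2 + (qim1 x)\<^sup>2 + (qim2 x)\<^sup>2 + (qim3 x)\<^sup>2"
  have "N \<noteq> 0"
    using \<open>x \<noteq> 0\<close> by (auto simp: N_def quat_eq_iff add_nonneg_eq_0_iff)
  then have one: "qre x * qre x / N + qim1 x * qim1 x / N + qim2 x * qim2 x / N + qim3 x * qim3 x / N = 1"
    by (simp add: add_divide_distrib [symmetric]) (simp add: N_def power2_eq_square)
  show "inverse x * x = 1" "x * inverse x = 1"
    using one by (simp_all add: quat_eq_iff N_def [symmetric] mult.commute)
qed

end

instantiation quat :: real_normed_div_algebra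
begin

definition norm_quat_def:
  "norm x = sqrt ((qre x)\<^sup>2 + (qim1 x)\<^sup>2 + (qim2 x)\<^sup>2 + (qim3 x)\<^sup>2)"

definition sgn_quat_def: "sgn x = x /\<^sub>R norm x" for x :: quat

definition dist_quat_def: "dist x y = norm (x - y)" for x y :: quat

definition uniformity_quat_def [code del]:
  "(uniformity :: (quat \<times> quat) filter) = (INF e\<in>{0 <..}. principal {(x, y). dist x y < e})"

definition open_quat_def [code del]:
  "open (U :: quat set) \<longleftrightarrow> (\<forall>x\<in>U. eventually (\<lambda>(x', y). x' = x \<longrightarrow> y \<in> U) uniformity)"

instance
proof
  fix r :: real and x y :: quat and S :: "quat set"
  show "norm x = 0 \<longleftrightarrow> x = 0"
    by (simp add: norm_quat_def quat_eq_iff add_nonneg_eq_0_iff)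
  have emb: "norm z = norm ((qre z, qim1 z), (qim2 z, qim3 z))" for z :: quat
    by (simp add: norm_quat_def norm_Pair add.assoc)
  show "norm (x + y) \<le> norm x + norm y"
    using norm_triangle_ineq [of "((qre x, qim1 x), (qim2 x, qim3 x))" "((qre y, qim1 y), (qim2 y, qim3 y))"]
    by (simp add: emb)
  show "norm (r *\<^sub>R x) = \<bar>r\<bar> * norm x"
    using norm_scaleR [of r "((qre x, qim1 x), (qim2 x, qim3 x))"]
    by (simp add: emb)
  have "(qre (x * y))\<^sup>2 + (qim1 (x * y))\<^sup>2 + (qim2 (x * y))\<^sup>2 + (qim3 (x * y))\<^sup>2
      = ((qre x)\<^sup>2 + (qim1 x)\<^sup>2 + (qim2 x)\<^sup>2 + (qim3 x)\<^sup>2) *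
        ((qre y)\<^sup>2 + (qim1 y)\<^sup>2 + (qim2 y)\<^sup>2 + (qim3 y)\<^sup>2)"
    unfolding times_quat.sel by algebra
  then show "norm (x * y) = norm x * norm y"
    by (simp only: norm_quat_def real_sqrt_mult [symmetric])
qed (rule sgn_quat_def dist_quat_def open_quat_def uniformity_quat_def)+

end

instantiation quat :: real_inner
begin

definition inner_quat_def:
  "inner x y = qre x * qre y + qim1 x * qim1 y + qim2 x * qim2 y + qim3 x * qim3 y"

instance
proof
  fix x y z :: quat and r :: real
  show "inner x y = inner y x"
    by (simp add: inner_quat_def mult.commute)
  show "inner (x + y) z = inner x z + inner y z"
    by (simp add: inner_quat_def distrib_right)
  show "inner (r *\<^sub>R x) y = r * inner x y"
    by (simp add: inner_quat_def distrib_left)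
  show "0 \<le> inner x x"
    by (simp add: inner_quat_def)
  show "inner x x = 0 \<longleftrightarrow> x = 0"
    by (simp add: inner_quat_def quat_eq_iff add_nonneg_eq_0_iff)
  show "norm x = sqrt (inner x x)"
    by (simp add: inner_quat_def norm_quat_def power2_eq_square)
qed

end

instantiation quat :: euclidean_space
begin

definition Basis_quat_def: "Basis = {1, qi, qj, qk}"

instance
proof
  show "(Basis :: quat set) \<noteq> {}" "finite (Basis :: quat set)"
    by (simp_all add: Basis_quat_def)
next
  fix x :: quat
  show "(\<forall>u\<in>Basis. inner x u = 0) \<longleftrightarrow> x = 0"
    by (simp add: Basis_quat_def inner_quat_def qi_def qj_def qk_def quat_eq_iff [of x 0])
next
  fix u v :: quat
  assume "u \<in> Basis" "v \<in> Basis"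
  then show "inner u v = (if u = v then 1 else 0)"
    unfolding Basis_quat_def
    by (elim insertE emptyE) (simp_all add: inner_quat_def qi_def qj_def qk_def quat_eq_iff)
qed

end


section \<open>Quaternionic matrices\<close>

definition mpow :: "quat^'n^'n \<Rightarrow> nat \<Rightarrow> quat^'n^'n" where
  "mpow X k = ((\<lambda>Y. X ** Y) ^^ k) (mat 1)"

definition mexp :: "quat^'n^'n \<Rightarrow> quat^'n^'n" where
  "mexp X = (\<Sum>k. mpow X k /\<^sub>R fact k)"

lemma mexp_sums:
  fixes X :: "quat^'n^'n"
  shows "(\<lambda>k. mpow X k /\<^sub>R fact k) sums mexp X"
proof -
  define c where "c = (\<Sum>i\<in>UNIV. \<Sum>j\<in>UNIV. norm (X $ i $ j))"
  have c0: "c \<ge> 0" by (simp add: c_def sum_nonneg)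
  have row: "(\<Sum>l\<in>UNIV. norm (X $ i $ l)) \<le> c" for i
    unfolding c_def by (rule member_le_sum) (auto intro: sum_nonneg)
  have entry: "norm (mpow X k $ i $ j) \<le> c ^ k" for k i j
  proof (induction k arbitrary: i j)
    case 0
    show ?case by (simp add: mpow_def mat_def)
  next
    case (Suc k)
    have "norm (mpow X (Suc k) $ i $ j) = norm (\<Sum>l\<in>UNIV. X $ i $ l * mpow X k $ l $ j)"
      by (simp add: mpow_def matrix_matrix_mult_def)
    also have "\<dots> \<le> (\<Sum>l\<in>UNIV. norm (X $ i $ l) * c ^ k)"
      by (intro sum_norm_le) (simp add: norm_mult Suc mult_left_mono)
    also have "\<dots> \<le> c * c ^ k"
      using row [of i] c0 by (simp add: sum_distrib_right [symmetric] mult_right_mono)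
    finally show ?case by simp
  qed
  have "norm M \<le> (\<Sum>i\<in>UNIV. \<Sum>j\<in>UNIV. norm (M $ i $ j))" for M :: "quat^'n^'n"
  proof -
    have "norm M \<le> (\<Sum>i\<in>UNIV. norm (M $ i))"
      unfolding norm_vec_def by (rule L2_set_le_sum) simp
    also have "\<dots> \<le> (\<Sum>i\<in>UNIV. \<Sum>j\<in>UNIV. norm (M $ i $ j))"
      unfolding norm_vec_def by (intro sum_mono L2_set_le_sum) simp
    finally show ?thesis .
  qed
  also have "(\<Sum>i\<in>UNIV. \<Sum>j\<in>UNIV. norm (mpow X k $ i $ j)) \<le> (\<Sum>i::'n\<in>UNIV. \<Sum>j::'n\<in>UNIV. c ^ k)" for k
    by (intro sum_mono entry)
  finally have "norm (mpow X k) \<le> real (CARD('n)) * real (CARD('n)) * c ^ k" for k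
    by (simp add: mult.assoc)
  then have bnd: "norm (mpow X k /\<^sub>R fact k) \<le> real (CARD('n)) * real (CARD('n)) * (c ^ k /\<^sub>R fact k)" for k
    by (simp add: field_simps)
  have "summable (\<lambda>k. real (CARD('n)) * real (CARD('n)) * (c ^ k /\<^sub>R fact k))"
    by (intro summable_mult summable_exp_generic)
  then have "summable (\<lambda>k. mpow X k /\<^sub>R fact k)"
    by (rule summable_comparison_test' [where N = 0]) (rule bnd)
  then show ?thesis
    by (simp add: mexp_def summable_sums)
qed

text \<open>
  Identification of the quaternionic column space of dimension \<open>n\<close> with the real one of
  dimension \<open>4n\<close>; the coordinate \<open>(r, c)\<close> is the \<open>c\<close>-th real component of
  the \<open>r\<close>-th entry. By \<open>real_matrix_mult_realify\<close> below, \<open>real_matrix g\<close> is the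
  matrix of the real-linear map \<open>x \<mapsto> g *v x\<close> in these coordinates. (The library's \<open>det\<close>
  only makes sense over a commutative ring and cannot be applied to \<open>g\<close> itself.)
\<close>

definition realify :: "quat^'n \<Rightarrow> real^('n \<times> 4)" where
  "realify x = (\<chi> p. (vector [qre (x $ fst p), qim1 (x $ fst p), qim2 (x $ fst p), qim3 (x $ fst p)]
                        :: real^4) $ snd p)"

definition unrealify :: "real^('n \<times> 4) \<Rightarrow> quat^'n" where
  "unrealify y = (\<chi> r. Quat (y $ (r, 1)) (y $ (r, 2)) (y $ (r, 3)) (y $ (r, 4)))"

definition real_matrix :: "quat^'n^'n \<Rightarrow> real^('n \<times> 4)^('n \<times> 4)" where
  "real_matrix g = matrix (\<lambda>y. realify (g *v unrealify y))"

lemma vector_4_nth: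
  "(vector [a, b, c, d] :: 'a::zero^4) $ 1 = a" "(vector [a, b, c, d] :: 'a::zero^4) $ 2 = b"
  "(vector [a, b, c, d] :: 'a::zero^4) $ 3 = c" "(vector [a, b, c, d] :: 'a::zero^4) $ 4 = d"
  by (simp_all add: vector_def)

lemma unrealify_realify [simp]: "unrealify (realify x) = x"
  by (simp add: unrealify_def realify_def vec_eq_iff quat_eq_iff vector_4_nth)

lemma realify_unrealify [simp]: "realify (unrealify y) = y"
  by (simp add: unrealify_def realify_def vec_eq_iff forall_4 vector_4_nth)

lemma linear_realify: "linear realify"
  by (rule linearI) (simp_all add: realify_def vec_eq_iff forall_4 vector_4_nth)

lemma linear_unrealify: "linear unrealify"
  by (rule linearI) (simp_all add: unrealify_def vec_eq_iff quat_eq_iff)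

lemma real_matrix_mult_realify: "real_matrix g *v realify x = realify (g *v x)"
proof -
  have "linear (\<lambda>x. g *v x)"
    by (rule linearI)
      (simp_all add: matrix_vector_mult_def vec_eq_iff distrib_left sum.distrib scaleR_sum_right)
  then have lin: "linear (\<lambda>y. realify (g *v unrealify y))"
    using linear_compose [OF linear_compose [OF linear_unrealify] linear_realify, of "\<lambda>x. g *v x"]
    by (simp add: o_def)
  have "Vector_Spaces.linear (*s) (*s) (\<lambda>y. realify (g *v unrealify y))"
    using lin by (simp add: linear_def scalar_mult_eq_scaleR [abs_def])
  from matrix_works [OF this] show ?thesis
    by (simp add: real_matrix_def)
qed

definition SL :: "(quat^'n^'n) set" where
  "SL = {g. invertible g \<and> det (real_matrix g) = 1}"

definition sl :: "(quat^'n^'n) set" where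
  "sl = {X. qre (trace X) = 0}"

definition lie_bracket :: "quat^'n^'n \<Rightarrow> quat^'n^'n \<Rightarrow> quat^'n^'n" where
  "lie_bracket X Y = X ** Y - Y ** X"

definition real_lie_subalgebra :: "(quat^'n^'n) set \<Rightarrow> bool" where
  "real_lie_subalgebra L \<longleftrightarrow> subspace L \<and> (\<forall>X\<in>L. \<forall>Y\<in>L. lie_bracket X Y \<in> L)"

definition generated_lie_algebra :: "(quat^'n^'n) set \<Rightarrow> (quat^'n^'n) set" where
  "generated_lie_algebra S = real_lie_subalgebra hull S"


section \<open>Controllability\<close>

text \<open>No closure is taken: products are finite, and the identity is the case \<open>t = 0\<close>.\<close>

inductive_set control_semigroup :: "quat^'n^'n \<Rightarrow> quat^'n^'n \<Rightarrow> (quat^'n^'n) set"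
  for A B :: "quat^'n^'n" where
  generator: "0 \<le> t \<Longrightarrow> mexp (t *\<^sub>R (A + u *\<^sub>R B)) \<in> control_semigroup A B"
| product: "g \<in> control_semigroup A B \<Longrightarrow> h \<in> control_semigroup A B \<Longrightarrow>
    g ** h \<in> control_semigroup A B"

definition controllable :: "quat^'n^'n \<Rightarrow> quat^'n^'n \<Rightarrow> bool" where
  "controllable A B \<longleftrightarrow> control_semigroup A B = SL"

end

theory Submission
  imports Defs
begin

text \<open>
  Let \<open>S\<close> be the control semigroup. The directions \<open>X\<close> that \<open>S\<close> can follow approximately form its
  \<^emph>\<open>Lie saturate\<close>: for every \<open>T\<close> the curve \<open>t \<mapsto> exp (t X)\<close> on \<open>[0, T]\<close> is a uniform limit of
  \<^emph>\<open>continuous\<close> curves with values in \<open>S\<close>. By Trotter's product formula the Lie saturate is a closed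
  convex cone. Its edge, consisting of the \<open>X\<close> for which both \<open>X\<close> and \<open>- X\<close> belong to it, is a closed Lie algebra,
  and conjugation by the exponential of an edge element preserves the Lie saturate. The matrix \<open>A\<close>
  lies in the Lie saturate, and since the controls are unrestricted, \<open>B\<close> lies in the edge: up to the
  factor \<open>1 / u\<close>, the direction \<open>A + u B\<close> tends to \<open>\<plusminus>B\<close>. The proof shows that the edge is all of
  \<open>sl(n, H)\<close>.

  Conjugation by \<open>exp (t B)\<close> multiplies the \<open>(r, s)\<close> entry of \<open>A\<close> by \<open>exp (t (a r - a s))\<close> and rotates
  it. The corner entry \<open>(1, n)\<close> grows strictly faster than all others, so after rescaling a corner
  matrix with entry \<open>x\<close> remains in the limit, where \<open>x\<close> is a limit of rotated copies of \<open>p\<close>.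
  The rotations act on the planes spanned by \<open>1, i\<close> and by \<open>j, k\<close> with incommensurable speeds, both
  components of \<open>p\<close> are nonzero, and hence the convex cone of all admissible corner entries is the whole of
  \<open>H\<close> (\<open>rotation_invariant_cone_quat\<close>, \<open>extremal_root_space\<close>). With \<open>t \<rightarrow> - \<infinity>\<close>
  the opposite corner is obtained in the same way.

  The two corners generate a copy of \<open>sl(2, H)\<close> in the edge. Its element \<open>E\<^sub>1\<^sub>1 - E\<^sub>n\<^sub>n\<close> grades the
  matrices by weights between \<open>-2\<close> and \<open>2\<close>. The part of weight \<open>\<plusminus>1\<close> of any element of the Lie saturate
  lies in the edge: a rescaled limit isolates it, and an element of the corner group reverses
  its sign (\<open>weight_one_part_in_edge\<close>). This argument does not reach the part of weight \<open>0\<close>, so that \<open>A\<close> itself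
  cannot be placed in the edge directly. Instead, the edge elements of pure nonzero weight
  generate a Lie algebra \<open>K\<close> that brackets with \<open>A\<close> and \<open>B\<close> preserve (\<open>bracket_with_root_elements\<close>). As \<open>A\<close>
  and \<open>B\<close> generate \<open>sl(n, H)\<close>, \<open>K\<close> is stable under brackets with all of \<open>sl(n, H)\<close>, and a subspace with this
  property that contains the two corners is everything (\<open>ideal_is_everything\<close>).

  It remains to pass from approximate to exact reachability. Since the approximations are uniform and
  continuous, Brouwer's fixed point theorem applies: coordinates of the second kind, perturbed slightly so
  as to take values in \<open>S\<close>, still cover a neighbourhood of the identity in \<open>Sl(n, H)\<close>
  (\<open>semigroup_covers_neighbourhood\<close>). Therefore \<open>S\<close> contains the exponential of every element of \<open>sl(n, H)\<close>, and by row
  reduction these exponentials generate \<open>Sl(n, H)\<close> (\<open>special_linear_subset_exp_group\<close>).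
\<close>

section \<open>The exponential in a Banach algebra\<close>

lemma norm_power_Suc_diff_le:
  fixes x y :: "'a::real_normed_algebra_1"
  assumes "norm x \<le> M" "norm y \<le> M"
  shows "norm (x ^ Suc n - y ^ Suc n) \<le> real (Suc n) * M ^ n * norm (x - y)"
proof (induction n)
  case 0
  show ?case by simp
next
  case (Suc n)
  have M: "0 \<le> M" using assms(1) norm_ge_zero order_trans by blast
  have "x ^ Suc (Suc n) - y ^ Suc (Suc n) = x * (x ^ Suc n - y ^ Suc n) + (x - y) * y ^ Suc n"
    by (simp add: algebra_simps)
  also have "norm \<dots> \<le> norm x * norm (x ^ Suc n - y ^ Suc n) + norm (x - y) * norm (y ^ Suc n)"
    by (intro norm_triangle_le add_mono norm_mult_ineq)
  also have "\<dots> \<le> M * (real (Suc n) * M ^ n * norm (x - y)) + norm (x - y) * M ^ Suc n"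
    using Suc assms M
    by (intro add_mono mult_mono order_trans [OF norm_power_ineq] power_mono) auto
  also have "\<dots> = real (Suc (Suc n)) * M ^ Suc n * norm (x - y)"
    by (simp add: algebra_simps)
  finally show ?case .
qed

lemma norm_exp_diff_le:
  fixes x y :: "'a::{real_normed_algebra_1,banach}"
  assumes "norm x \<le> M" "norm y \<le> M"
  shows "norm (exp x - exp y) \<le> exp M * norm (x - y)"
proof -
  let ?f = "\<lambda>k. (x ^ k - y ^ k) /\<^sub>R fact k"
  have "(\<lambda>k. x ^ k /\<^sub>R fact k - y ^ k /\<^sub>R fact k) sums (exp x - exp y)"
    by (intro sums_diff exp_converges)
  then have "?f sums (exp x - exp y)"
    by (simp add: scaleR_diff_right)
  then have s: "(\<lambda>k. ?f (Suc k)) sums (exp x - exp y)"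
    by (subst sums_Suc_iff) simp
  have g: "(\<lambda>k. M ^ k /\<^sub>R fact k * norm (x - y)) sums (exp M * norm (x - y))"
    by (intro sums_mult2 exp_converges)
  have bound: "norm (?f (Suc k)) \<le> M ^ k /\<^sub>R fact k * norm (x - y)" for k
  proof -
    have "norm (?f (Suc k)) = norm (x ^ Suc k - y ^ Suc k) / fact (Suc k)"
      by (simp add: divide_inverse mult.commute)
    also have "\<dots> \<le> (real (Suc k) * M ^ k * norm (x - y)) / fact (Suc k)"
      using norm_power_Suc_diff_le [OF assms, of k] by (intro divide_right_mono) auto
    also have "\<dots> = M ^ k /\<^sub>R fact k * norm (x - y)"
      by (simp add: divide_simps del: of_nat_Suc)
    finally show ?thesis .
  qed
  show ?thesis
    using norm_suminf_le [OF bound sums_summable [OF g]] s g unfolding sums_iff by metis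
qed

lemma exp_power_scaleR:
  fixes x :: "'a::{real_normed_algebra_1,banach}"
  shows "exp x ^ n = exp (real n *\<^sub>R x)"
proof (induction n)
  case (Suc n)
  have "exp (real (Suc n) *\<^sub>R x) = exp (x + real n *\<^sub>R x)"
    by (simp add: scaleR_add_left)
  also have "\<dots> = exp x * exp (real n *\<^sub>R x)"
    by (rule exp_add_commuting) simp
  finally show ?case using Suc by simp
qed simp

text \<open>Applied to conjugations, and to the embeddings of the complex numbers into the quaternions.\<close>

lemma exp_algebra_hom:
  fixes h :: "'a::{real_normed_algebra_1,banach} \<Rightarrow> 'b::{real_normed_algebra_1,banach}"
  assumes h: "bounded_linear h" and one: "h 1 = 1" and mult: "\<And>x y. h (x * y) = h x * h y"
  shows "h (exp x) = exp (h x)"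
proof -
  have pow: "h (x ^ n) = h x ^ n" for n
    by (induction n) (simp_all add: one mult)
  have "(\<lambda>n. h (x ^ n /\<^sub>R fact n)) sums h (exp x)"
    by (intro bounded_linear.sums [OF h] exp_converges)
  then have "(\<lambda>n. h x ^ n /\<^sub>R fact n) sums h (exp x)"
    by (simp add: linear_simps(5) [OF h] pow)
  then show ?thesis
    by (rule sums_unique2 [OF _ exp_converges])
qed

lemma exp_minus_mult [simp]:
  fixes x :: "'a::{real_normed_algebra_1,banach}"
  shows "exp (- x) * exp x = 1" "exp x * exp (- x) = 1"
  using exp_minus_inverse [of x] exp_minus_inverse [of "- x"] by simp_all

lemma exp_conjugate:
  fixes x :: "'a::{real_normed_algebra_1,banach}"
  assumes "u * v = 1" "v * u = 1"
  shows "exp (u * x * v) = u * exp x * v"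
proof -
  define h where "h = (\<lambda>x. u * x * v)"
  have "bounded_linear h"
    unfolding h_def
    by (rule bounded_linear_compose [OF bounded_linear_mult_left bounded_linear_mult_right])
  moreover have "h 1 = 1"
    by (simp add: h_def assms(1))
  moreover have "h (x * y) = h x * h y" for x y
  proof -
    have "h x * h y = u * x * (v * u) * y * v"
      unfolding h_def by (simp only: mult.assoc)
    then show ?thesis by (simp add: h_def assms(2) mult.assoc)
  qed
  ultimately have "h (exp x) = exp (h x)"
    by (rule exp_algebra_hom)
  then show ?thesis by (simp add: h_def)
qed

lemma exp_square_zero:
  fixes x :: "'a::{real_normed_algebra_1,banach}"
  assumes "x * x = 0"
  shows "exp x = 1 + x"
proof -
  have z: "x ^ n = 0" if "n \<notin> {0, 1}" for n
  proof -
    have "n = Suc (Suc (n - 2))"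
      using that by auto
    then have "x ^ n = x * x * x ^ (n - 2)"
      by (metis mult.assoc power_Suc)
    then show ?thesis by (simp add: assms)
  qed
  have "(\<lambda>n. x ^ n /\<^sub>R fact n) sums (\<Sum>n\<in>{0, 1}. x ^ n /\<^sub>R fact n)"
    by (rule sums_finite) (simp_all add: z)
  then show ?thesis
    using sums_unique2 [OF exp_converges [of x]] by fastforce
qed

lemma exp_curve_derivative:
  fixes x :: "'a::{real_normed_algebra_1,banach}"
  shows "((\<lambda>s. exp (s *\<^sub>R x)) has_vector_derivative x) (at 0)"
  using exp_scaleR_has_vector_derivative_right [of x 0 UNIV] by simp

lemma continuous_on_exp_curve:
  fixes x :: "'a::{real_normed_algebra_1,banach}"
  shows "continuous_on T (\<lambda>s. exp (s *\<^sub>R x))"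
  by (intro continuous_at_imp_continuous_on ballI
      has_vector_derivative_continuous [OF exp_scaleR_has_vector_derivative_right])

lemma exp_conjugation_derivative:
  fixes x y :: "'a::{real_normed_algebra_1,banach}"
  shows "((\<lambda>s. exp (s *\<^sub>R x) * y * exp (s *\<^sub>R (- x))) has_vector_derivative (x * y - y * x)) (at 0)"
proof -
  have "((\<lambda>s. exp (s *\<^sub>R x) * y * exp (s *\<^sub>R (- x))) has_vector_derivative
      (exp (0 *\<^sub>R x) * y * (- x) + x * y * exp (0 *\<^sub>R (- x)))) (at 0)"
    by (intro has_vector_derivative_mult has_vector_derivative_mult_left exp_curve_derivative)
  then show ?thesis by (simp add: algebra_simps)
qed

text \<open>Difference quotients stay in the subspace, and so does their limit. With the curve of
  \<open>exp_conjugation_derivative\<close> this turns invariance under conjugation into invariance under brackets.\<close>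

lemma derivative_in_closed_subspace:
  fixes f :: "real \<Rightarrow> 'a::real_normed_vector"
  assumes "closed L" "subspace L" "\<And>s. f s \<in> L" and f: "(f has_vector_derivative D) (at 0)"
  shows "D \<in> L"
proof -
  have lim: "((\<lambda>s. norm (f s - f 0 - s *\<^sub>R D) / \<bar>s\<bar>) \<longlongrightarrow> 0) (at 0)"
    using f by (simp add: has_vector_derivative_def has_derivative_iff_norm)
  have eq: "norm (f s - f 0 - s *\<^sub>R D) / \<bar>s\<bar> = norm ((f s - f 0) /\<^sub>R s - D)" if "s \<noteq> 0" for s
  proof -
    have "f s - f 0 - s *\<^sub>R D = s *\<^sub>R ((f s - f 0) /\<^sub>R s - D)"
      using that by (simp add: scaleR_diff_right)
    then have "norm (f s - f 0 - s *\<^sub>R D) = \<bar>s\<bar> * norm ((f s - f 0) /\<^sub>R s - D)"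
      by (metis norm_scaleR)
    then show ?thesis using that by simp
  qed
  have "((\<lambda>s. norm ((f s - f 0) /\<^sub>R s - D)) \<longlongrightarrow> 0) (at 0)"
    by (rule Lim_transform_within [OF lim zero_less_one]) (rule eq, simp)
  then have "((\<lambda>s. (f s - f 0) /\<^sub>R s) \<longlongrightarrow> D) (at 0)"
    by (metis LIM_zero_cancel tendsto_norm_zero_cancel)
  moreover have "\<forall>\<^sub>F s in at 0. (f s - f 0) /\<^sub>R s \<in> L"
    using assms by (intro always_eventually allI subspace_scale subspace_diff) auto
  ultimately show ?thesis
    by (intro Lim_in_closed_set [OF \<open>closed L\<close>]) auto
qed

section \<open>Maps approximated by continuous maps into a semigroup\<close>

text \<open>Continuity of the approximating maps is what Brouwer's theorem needs later; values in the
  closure of \<open>S\<close> alone would not tell which points \<open>S\<close> itself contains.\<close>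

definition approximable :: "'p::topological_space set \<Rightarrow> 'a::real_normed_vector set \<Rightarrow> ('p \<Rightarrow> 'a) \<Rightarrow> bool" where
  "approximable K S \<phi> \<longleftrightarrow>
    (\<forall>\<epsilon>>0. \<exists>\<sigma>. continuous_on K \<sigma> \<and> \<sigma> ` K \<subseteq> S \<and> (\<forall>x\<in>K. norm (\<sigma> x - \<phi> x) < \<epsilon>))"

lemma approximable_self:
  assumes "continuous_on K \<phi>" "\<phi> ` K \<subseteq> S"
  shows "approximable K S \<phi>"
  unfolding approximable_def using assms by (intro allI impI exI [of _ \<phi>]) auto

lemma approximable_uniform_limit:
  assumes "\<And>\<epsilon>. \<epsilon> > 0 \<Longrightarrow> \<exists>\<psi>. approximable K S \<psi> \<and> (\<forall>x\<in>K. norm (\<psi> x - \<phi> x) < \<epsilon>)"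
  shows "approximable K S \<phi>"
  unfolding approximable_def
proof (intro allI impI)
  fix \<epsilon> :: real assume "\<epsilon> > 0"
  then obtain \<psi> where psi: "approximable K S \<psi>" "\<forall>x\<in>K. norm (\<psi> x - \<phi> x) < \<epsilon> / 2"
    using assms [of "\<epsilon> / 2"] by auto
  then obtain \<sigma> where sig: "continuous_on K \<sigma>" "\<sigma> ` K \<subseteq> S" "\<forall>x\<in>K. norm (\<sigma> x - \<psi> x) < \<epsilon> / 2"
    unfolding approximable_def using \<open>\<epsilon> > 0\<close> by (meson half_gt_zero)
  have "norm (\<sigma> x - \<phi> x) < \<epsilon>" if "x \<in> K" for x
    using norm_triangle_lt [of "\<sigma> x - \<psi> x" "\<psi> x - \<phi> x" \<epsilon>] psi(2) sig(3) that by fastforce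
  with sig show "\<exists>\<sigma>. continuous_on K \<sigma> \<and> \<sigma> ` K \<subseteq> S \<and> (\<forall>x\<in>K. norm (\<sigma> x - \<phi> x) < \<epsilon>)"
    by blast
qed

lemma approximable_compose:
  assumes "approximable K S \<phi>" "continuous_on K' h" "h ` K' \<subseteq> K"
  shows "approximable K' S (\<lambda>x. \<phi> (h x))"
  unfolding approximable_def
proof (intro allI impI)
  fix \<epsilon> :: real assume "\<epsilon> > 0"
  then obtain \<sigma> where sig: "continuous_on K \<sigma>" "\<sigma> ` K \<subseteq> S" "\<forall>x\<in>K. norm (\<sigma> x - \<phi> x) < \<epsilon>"
    using assms(1) unfolding approximable_def by meson
  then have "continuous_on K' (\<lambda>x. \<sigma> (h x))"
    using assms continuous_on_compose2 by blast
  with sig assms(3) show "\<exists>\<sigma>. continuous_on K' \<sigma> \<and> \<sigma> ` K' \<subseteq> S \<and> (\<forall>x\<in>K'. norm (\<sigma> x - \<phi> (h x)) < \<epsilon>)"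
    by (intro exI [of _ "\<lambda>x. \<sigma> (h x)"]) (simp add: image_subset_iff)
qed

lemma approximable_mult:
  fixes \<phi> \<psi> :: "'p::topological_space \<Rightarrow> 'a::real_normed_algebra"
  assumes S: "\<And>x y. x \<in> S \<Longrightarrow> y \<in> S \<Longrightarrow> x * y \<in> S"
    and phi: "approximable K S \<phi>" "bounded (\<phi> ` K)"
    and psi: "approximable K S \<psi>" "bounded (\<psi> ` K)"
  shows "approximable K S (\<lambda>x. \<phi> x * \<psi> x)"
  unfolding approximable_def
proof (intro allI impI)
  fix \<epsilon> :: real assume eps: "\<epsilon> > 0"
  obtain M1 M2 where M1: "\<forall>x\<in>K. norm (\<phi> x) \<le> M1" and M2: "\<forall>x\<in>K. norm (\<psi> x) \<le> M2"
    using phi(2) psi(2) by (auto simp: bounded_iff)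
  define M where "M = \<bar>M1\<bar> + \<bar>M2\<bar> + 1"
  define \<delta> where "\<delta> = min 1 (\<epsilon> / (3 * M))"
  have M: "M \<ge> 1" by (simp add: M_def)
  then have del: "\<delta> > 0" "\<delta> \<le> 1" "M * \<delta> \<le> \<epsilon> / 3"
    using eps by (auto simp: \<delta>_def min_def field_simps)
  obtain \<sigma> where sig: "continuous_on K \<sigma>" "\<sigma> ` K \<subseteq> S" "\<forall>x\<in>K. norm (\<sigma> x - \<phi> x) < \<delta>"
    using phi(1) del unfolding approximable_def by meson
  obtain \<tau> where tau: "continuous_on K \<tau>" "\<tau> ` K \<subseteq> S" "\<forall>x\<in>K. norm (\<tau> x - \<psi> x) < \<delta>"
    using psi(1) del unfolding approximable_def by meson
  have "norm (\<sigma> x * \<tau> x - \<phi> x * \<psi> x) < \<epsilon>" if x: "x \<in> K" for x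
  proof -
    have nt: "norm (\<tau> x) \<le> M"
    proof -
      have "norm (\<tau> x) \<le> norm (\<tau> x - \<psi> x) + norm (\<psi> x)"
        using norm_triangle_sub by (simp add: add.commute)
      then show ?thesis
        using x M2 tau(3) del(2) unfolding M_def by fastforce
    qed
    have np: "norm (\<phi> x) \<le> M"
      using x M1 unfolding M_def by fastforce
    have "\<sigma> x * \<tau> x - \<phi> x * \<psi> x = (\<sigma> x - \<phi> x) * \<tau> x + \<phi> x * (\<tau> x - \<psi> x)"
      by (simp add: algebra_simps)
    also have "norm \<dots> \<le> norm (\<sigma> x - \<phi> x) * norm (\<tau> x) + norm (\<phi> x) * norm (\<tau> x - \<psi> x)"
      by (intro norm_triangle_le add_mono norm_mult_ineq)
    also have "\<dots> \<le> \<delta> * M + M * \<delta>"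
      using sig(3) tau(3) x nt np M del by (intro add_mono mult_mono) (auto intro: less_imp_le)
    also have "\<dots> < \<epsilon>"
      using del(3) eps by (simp add: mult.commute)
    finally show ?thesis .
  qed
  moreover have "(\<lambda>x. \<sigma> x * \<tau> x) ` K \<subseteq> S"
    using sig(2) tau(2) S by blast
  ultimately show "\<exists>\<sigma>. continuous_on K \<sigma> \<and> \<sigma> ` K \<subseteq> S \<and> (\<forall>x\<in>K. norm (\<sigma> x - \<phi> x * \<psi> x) < \<epsilon>)"
    by (intro exI [of _ "\<lambda>x. \<sigma> x * \<tau> x"] conjI continuous_on_mult sig tau) auto
qed

lemma approximable_power_Suc:
  fixes \<phi> :: "'p::topological_space \<Rightarrow> 'a::real_normed_algebra_1"
  assumes S: "\<And>x y. x \<in> S \<Longrightarrow> y \<in> S \<Longrightarrow> x * y \<in> S"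
    and phi: "approximable K S \<phi>" "bounded (\<phi> ` K)"
  shows "approximable K S (\<lambda>x. \<phi> x ^ Suc n)"
proof (induction n)
  case 0
  show ?case using phi by simp
next
  case (Suc n)
  obtain M where M: "\<forall>x\<in>K. norm (\<phi> x) \<le> M"
    using phi(2) by (auto simp: bounded_iff)
  have "bounded ((\<lambda>x. \<phi> x ^ Suc n) ` K)"
    unfolding bounded_iff
  proof (intro exI [of _ "\<bar>M\<bar> ^ Suc n"] ballI, clarify)
    fix x assume "x \<in> K"
    then have "norm (\<phi> x) \<le> \<bar>M\<bar>" using M by fastforce
    then show "norm (\<phi> x ^ Suc n) \<le> \<bar>M\<bar> ^ Suc n"
      using norm_power_ineq power_mono norm_ge_zero order_trans by metis
  qed
  then have "approximable K S (\<lambda>x. \<phi> x * \<phi> x ^ Suc n)"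
    by (intro approximable_mult S phi Suc.IH)
  then show ?case by simp
qed

section \<open>The Lie saturate of a semigroup\<close>

definition lie_saturate :: "'a::{real_normed_algebra_1,banach} set \<Rightarrow> 'a set" where
  "lie_saturate S = {X. \<forall>T\<ge>0. approximable {0..T} S (\<lambda>t. exp (t *\<^sub>R X))}"

definition lie_edge :: "'a::{real_normed_algebra_1,banach} set \<Rightarrow> 'a set" where
  "lie_edge S = {X. X \<in> lie_saturate S \<and> - X \<in> lie_saturate S}"

lemma bounded_exp_curve:
  fixes X :: "'a::{real_normed_algebra_1,banach}"
  shows "bounded ((\<lambda>t. exp (t *\<^sub>R X)) ` {0..T})"
  by (intro compact_imp_bounded compact_continuous_image continuous_on_exp_curve compact_Icc)

lemma lie_saturateI:
  assumes "\<And>t. t \<ge> 0 \<Longrightarrow> exp (t *\<^sub>R X) \<in> S"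
  shows "X \<in> lie_saturate S"
  unfolding lie_saturate_def using assms
  by (auto intro!: approximable_self continuous_on_exp_curve)

lemma closed_lie_saturate: "closed (lie_saturate S)"
  unfolding closed_sequential_limits
proof (intro allI impI, elim conjE)
  fix X :: "nat \<Rightarrow> 'a" and l
  assume X: "\<forall>n. X n \<in> lie_saturate S" and lim: "X \<longlonglongrightarrow> l"
  show "l \<in> lie_saturate S"
    unfolding lie_saturate_def
  proof (clarify, rule approximable_uniform_limit)
    fix T \<epsilon> :: real assume T: "T \<ge> 0" and eps: "\<epsilon> > 0"
    define M where "M = T * (norm l + 1)"
    define m where "m = exp M * (T + 1)"
    define \<delta> where "\<delta> = min 1 (\<epsilon> / m)"
    have "m > 0" using T by (simp add: m_def)
    then have del: "\<delta> > 0" "\<delta> \<le> 1" "m * \<delta> \<le> \<epsilon>"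
      using eps by (auto simp: \<delta>_def min_def field_simps)
    obtain n where n: "norm (X n - l) < \<delta>"
      using lim del(1) unfolding lim_sequentially dist_norm by blast
    have "norm (exp (t *\<^sub>R X n) - exp (t *\<^sub>R l)) < \<epsilon>" if t: "t \<in> {0..T}" for t
    proof -
      have "norm (X n) \<le> norm l + 1"
        using norm_triangle_sub [of "X n" l] n del(2) by linarith
      then have "norm (t *\<^sub>R X n) \<le> M" "norm (t *\<^sub>R l) \<le> M"
        unfolding M_def using t T by (auto intro!: mult_mono)
      then have "norm (exp (t *\<^sub>R X n) - exp (t *\<^sub>R l)) \<le> exp M * norm (t *\<^sub>R X n - t *\<^sub>R l)"
        by (rule norm_exp_diff_le)
      also have "\<dots> = exp M * t * norm (X n - l)"
        using t by (simp flip: scaleR_diff_right)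
      also have "\<dots> \<le> exp M * T * norm (X n - l)"
        using t by (intro mult_mono) auto
      also have "\<dots> \<le> exp M * T * \<delta>"
        using T n by (intro mult_left_mono) auto
      also have "\<dots> < m * \<delta>"
        using del by (simp add: m_def)
      finally show ?thesis using del(3) by linarith
    qed
    moreover have "approximable {0..T} S (\<lambda>t. exp (t *\<^sub>R X n))"
      using X T by (auto simp: lie_saturate_def)
    ultimately show "\<exists>\<psi>. approximable {0..T} S \<psi> \<and> (\<forall>x\<in>{0..T}. norm (\<psi> x - exp (x *\<^sub>R l)) < \<epsilon>)"
      by (intro exI [of _ "\<lambda>t. exp (t *\<^sub>R X n)"]) simp
  qed
qed

text \<open>A nonnegative factor only changes the speed at which the curve is traversed.\<close>

lemma lie_saturate_scale:
  assumes "X \<in> lie_saturate S" "r \<ge> 0"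
  shows "r *\<^sub>R X \<in> lie_saturate S"
  unfolding lie_saturate_def
proof clarify
  fix T :: real assume "T \<ge> 0"
  have "approximable {0..r * T} S (\<lambda>t. exp (t *\<^sub>R X))"
    using assms \<open>T \<ge> 0\<close> by (auto simp: lie_saturate_def)
  moreover have "(\<lambda>t. r * t) ` {0..T} \<subseteq> {0..r * T}"
    using assms by (auto intro: mult_left_mono)
  ultimately have "approximable {0..T} S (\<lambda>t. exp ((r * t) *\<^sub>R X))"
    by (intro approximable_compose [where h = "\<lambda>t. r * t"] continuous_intros)
  then show "approximable {0..T} S (\<lambda>t. exp (t *\<^sub>R r *\<^sub>R X))"
    by (simp add: mult.commute)
qed

text \<open>Both curves have the derivative \<open>X + Y\<close> at \<open>0\<close>, so that they agree to first order there.\<close>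

lemma Trotter_local_error:
  fixes X Y :: "'a::{real_normed_algebra_1,banach}"
  assumes "e > 0"
  obtains d where "d > 0"
    "\<And>h. \<bar>h\<bar> < d \<Longrightarrow> norm (exp (h *\<^sub>R X) * exp (h *\<^sub>R Y) - exp (h *\<^sub>R (X + Y))) \<le> e * \<bar>h\<bar>"
proof -
  let ?f = "\<lambda>h. exp (h *\<^sub>R X) * exp (h *\<^sub>R Y) - exp (h *\<^sub>R (X + Y))"
  have "(?f has_vector_derivative (exp (0 *\<^sub>R X) * Y + X * exp (0 *\<^sub>R Y) - (X + Y))) (at 0)"
    by (intro has_vector_derivative_diff has_vector_derivative_mult exp_curve_derivative)
  then have "(?f has_vector_derivative 0) (at 0)"
    by (simp add: add.commute)
  then have "\<exists>d>0. \<forall>h. norm (h - 0) < d \<longrightarrow> norm (?f h - ?f 0 - (h - 0) *\<^sub>R 0) \<le> e * norm (h - 0)"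
    unfolding has_vector_derivative_def has_derivative_at_alt using assms by blast
  then show ?thesis
    using that by auto
qed

text \<open>By Trotter's formula \<open>exp (t (X + Y))\<close> is the limit of \<open>(exp (t X / n) exp (t Y / n))\<^sup>n\<close>, uniformly for
  \<open>t\<close> in \<open>[0, T]\<close>: a local error \<open>e t / n\<close>, repeated \<open>n\<close> times, amounts to a multiple of \<open>e t\<close>.\<close>

lemma lie_saturate_add:
  assumes S: "\<And>x y. x \<in> S \<Longrightarrow> y \<in> S \<Longrightarrow> x * y \<in> S"
    and X: "X \<in> lie_saturate S" and Y: "Y \<in> lie_saturate S"
  shows "X + Y \<in> lie_saturate S"
  unfolding lie_saturate_def
proof (clarify, rule approximable_uniform_limit)
  fix T \<epsilon> :: real assume T: "T \<ge> 0" and eps: "\<epsilon> > 0"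
  define c where "c = norm X + norm Y"
  define C where "C = exp (T * c)"
  define e where "e = \<epsilon> / ((T + 1) * C)"
  have c: "c \<ge> 0" and C: "C > 0" and e: "e > 0" and e': "C * e * (T + 1) = \<epsilon>"
    using T eps by (auto simp: c_def C_def e_def)
  obtain d where d: "d > 0"
    "\<And>h. \<bar>h\<bar> < d \<Longrightarrow> norm (exp (h *\<^sub>R X) * exp (h *\<^sub>R Y) - exp (h *\<^sub>R (X + Y))) \<le> e * \<bar>h\<bar>"
    using Trotter_local_error [OF e] by metis
  obtain n where n: "T / d < real n"
    using reals_Archimedean2 by blast
  let ?P = "\<lambda>h. exp (h *\<^sub>R X) * exp (h *\<^sub>R Y)" and ?Q = "\<lambda>h. exp (h *\<^sub>R (X + Y))"
  have close: "norm (?P (t / Suc n) ^ Suc n - exp (t *\<^sub>R (X + Y))) < \<epsilon>" if t: "t \<in> {0..T}" for t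
  proof -
    define h where "h = t / Suc n"
    have h: "h \<ge> 0" "Suc n * h = t" using t by (auto simp: h_def)
    have "T < d * Suc n"
      using n d(1) by (simp add: field_simps)
    then have hd: "h < d" using t by (simp add: h_def divide_less_eq)
    have nP: "norm (?P h) \<le> exp (h * c)"
    proof -
      have "norm (?P h) \<le> exp (norm (h *\<^sub>R X)) * exp (norm (h *\<^sub>R Y))"
        by (intro order_trans [OF norm_mult_ineq] mult_mono norm_exp) auto
      then show ?thesis using h by (simp add: c_def distrib_left exp_add)
    qed
    have nQ: "norm (?Q h) \<le> exp (h * c)"
    proof -
      have "norm (?Q h) \<le> exp (norm (h *\<^sub>R (X + Y)))" by (rule norm_exp)
      also have "norm (h *\<^sub>R (X + Y)) \<le> h * c"
        using h norm_triangle_ineq [of X Y] by (simp add: c_def mult_left_mono)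
      finally show ?thesis by simp
    qed
    have hn: "exp (h * c) ^ n \<le> C"
    proof -
      have "real n * h \<le> T" using h t by (simp add: algebra_simps)
      then have "real n * h * c \<le> T * c" using c mult_right_mono by blast
      then show ?thesis
        by (simp add: C_def mult.assoc flip: exp_of_nat_mult)
    qed
    have "exp (t *\<^sub>R (X + Y)) = ?Q h ^ Suc n"
      using h by (simp add: exp_power_scaleR del: power_Suc of_nat_Suc)
    then have "norm (?P h ^ Suc n - exp (t *\<^sub>R (X + Y))) = norm (?P h ^ Suc n - ?Q h ^ Suc n)"
      by simp
    also have "\<dots> \<le> Suc n * exp (h * c) ^ n * norm (?P h - ?Q h)"
      by (rule norm_power_Suc_diff_le [OF nP nQ])
    also have "\<dots> \<le> Suc n * C * (e * h)"
      using d(2) [of h] hd h hn C by (intro mult_mono) auto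
    also have "\<dots> = C * e * t"
      using h(2) by (metis mult.assoc mult.commute)
    also have "\<dots> < \<epsilon>"
      unfolding e' [symmetric] using t C e by (intro mult_strict_left_mono) auto
    finally show ?thesis by (simp add: h_def)
  qed
  have appr: "approximable {0..T} S (\<lambda>t. exp ((t / Suc n) *\<^sub>R Z))" if "Z \<in> lie_saturate S" for Z
    using lie_saturate_scale [OF that, of "1 / Suc n"] T by (simp add: lie_saturate_def)
  have bdd: "bounded ((\<lambda>t. exp ((t / Suc n) *\<^sub>R Z)) ` {0..T})" for Z :: 'a
    using bounded_exp_curve [of "(1 / Suc n) *\<^sub>R Z" T] by simp
  have cont: "continuous_on {0..T} (\<lambda>t. exp ((t / Suc n) *\<^sub>R Z))" for Z :: 'a
    using continuous_on_exp_curve [of "{0..T}" "(1 / Suc n) *\<^sub>R Z"] by simp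
  have "bounded ((\<lambda>t. ?P (t / Suc n)) ` {0..T})"
    by (intro compact_imp_bounded compact_continuous_image compact_Icc continuous_on_mult cont)
  then have "approximable {0..T} S (\<lambda>t. ?P (t / Suc n) ^ Suc n)"
    by (intro approximable_power_Suc approximable_mult S appr X Y bdd)
  with close show "\<exists>\<psi>. approximable {0..T} S \<psi> \<and> (\<forall>x\<in>{0..T}. norm (\<psi> x - exp (x *\<^sub>R (X + Y))) < \<epsilon>)"
    by (intro exI [of _ "\<lambda>t. ?P (t / Suc n) ^ Suc n"]) simp
qed

text \<open>The conjugated curve is \<open>exp Y exp (t X) exp (- Y)\<close>, and its two constant outer factors can be approximated
  because \<open>Y\<close> and \<open>- Y\<close> both lie in the Lie saturate.\<close>

lemma lie_saturate_conjugate: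
  assumes S: "\<And>x y. x \<in> S \<Longrightarrow> y \<in> S \<Longrightarrow> x * y \<in> S"
    and X: "X \<in> lie_saturate S" and Y: "Y \<in> lie_edge S"
  shows "exp Y * X * exp (- Y) \<in> lie_saturate S"
  unfolding lie_saturate_def
proof clarify
  fix T :: real assume T: "T \<ge> 0"
  have const: "approximable {0..T} S (\<lambda>t. exp Z)" if "Z \<in> lie_saturate S" for Z
  proof -
    have "approximable {0..1} S (\<lambda>t. exp (t *\<^sub>R Z))"
      using that by (simp add: lie_saturate_def)
    then have "approximable {0..T} S (\<lambda>t. exp (1 *\<^sub>R Z))"
      by (rule approximable_compose [where h = "\<lambda>t. 1"]) auto
    then show ?thesis by simp
  qed
  have "approximable {0..T} S (\<lambda>t. exp Y * exp (t *\<^sub>R X) * exp (- Y))"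
    using X Y T
    by (intro approximable_mult S const compact_imp_bounded compact_continuous_image compact_Icc
        continuous_on_mult continuous_on_const continuous_on_exp_curve)
      (auto simp: lie_edge_def lie_saturate_def)
  moreover have "exp (t *\<^sub>R (exp Y * X * exp (- Y))) = exp Y * exp (t *\<^sub>R X) * exp (- Y)" for t
    using exp_conjugate [of "exp Y" "exp (- Y)" "t *\<^sub>R X"] by simp
  ultimately show "approximable {0..T} S (\<lambda>t. exp (t *\<^sub>R (exp Y * X * exp (- Y))))"
    by simp
qed

lemma lie_edge_subset: "lie_edge S \<subseteq> lie_saturate S"
  by (auto simp: lie_edge_def)

lemma closed_lie_edge: "closed (lie_edge S)"
proof -
  have "lie_edge S = lie_saturate S \<inter> uminus ` lie_saturate S"
    by (force simp: lie_edge_def image_iff)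
  then show ?thesis
    by (simp add: closed_Int closed_lie_saturate closed_negations)
qed

lemma subspace_lie_edge:
  assumes S: "\<And>x y. x \<in> S \<Longrightarrow> y \<in> S \<Longrightarrow> x * y \<in> S" and ne: "lie_saturate S \<noteq> {}"
  shows "subspace (lie_edge S)"
  unfolding subspace_def
proof (intro conjI ballI allI)
  obtain Z where "Z \<in> lie_saturate S" using ne by blast
  then have "0 \<in> lie_saturate S" using lie_saturate_scale [of Z S 0] by simp
  then show "0 \<in> lie_edge S" by (simp add: lie_edge_def)
next
  fix x y assume "x \<in> lie_edge S" "y \<in> lie_edge S"
  then show "x + y \<in> lie_edge S"
    using lie_saturate_add [OF S, of x y] lie_saturate_add [OF S, of "-x" "-y"]
    by (auto simp: lie_edge_def)
next
  fix c :: real and x assume x: "x \<in> lie_edge S"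
  show "c *\<^sub>R x \<in> lie_edge S"
    using lie_saturate_scale [of x S "\<bar>c\<bar>"] lie_saturate_scale [of "-x" S "\<bar>c\<bar>"] x
    by (cases "c \<ge> 0") (auto simp: lie_edge_def)
qed

lemma lie_edge_conjugate:
  assumes S: "\<And>x y. x \<in> S \<Longrightarrow> y \<in> S \<Longrightarrow> x * y \<in> S"
    and "X \<in> lie_edge S" and "Y \<in> lie_edge S"
  shows "exp Y * X * exp (- Y) \<in> lie_edge S"
  using lie_saturate_conjugate [OF S, of X Y] lie_saturate_conjugate [OF S, of "- X" Y] assms
  by (auto simp: lie_edge_def)

lemma lie_edge_bracket:
  assumes S: "\<And>x y. x \<in> S \<Longrightarrow> y \<in> S \<Longrightarrow> x * y \<in> S"
    and X: "X \<in> lie_edge S" and Y: "Y \<in> lie_edge S"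
  shows "X * Y - Y * X \<in> lie_edge S"
proof (rule derivative_in_closed_subspace [OF closed_lie_edge _ _ exp_conjugation_derivative])
  show sub: "subspace (lie_edge S)"
    using subspace_lie_edge [OF S] X by (auto simp: lie_edge_def)
  show "exp (s *\<^sub>R X) * Y * exp (s *\<^sub>R - X) \<in> lie_edge S" for s
    using lie_edge_conjugate [OF S Y, of "s *\<^sub>R X"] sub X by (simp add: subspace_scale)
qed

section \<open>The Banach algebra of quaternionic matrices\<close>

typedef 'n qmat = "UNIV :: (quat^'n^'n) set"
  morphisms mat_of qmat ..

setup_lifting type_definition_qmat

instantiation qmat :: (finite) ring_1
begin

lift_definition zero_qmat :: "'a qmat" is 0 .
lift_definition one_qmat :: "'a qmat" is "mat 1" .
lift_definition plus_qmat :: "'a qmat \<Rightarrow> 'a qmat \<Rightarrow> 'a qmat" is "(+)" .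
lift_definition minus_qmat :: "'a qmat \<Rightarrow> 'a qmat \<Rightarrow> 'a qmat" is "(-)" .
lift_definition uminus_qmat :: "'a qmat \<Rightarrow> 'a qmat" is uminus .
lift_definition times_qmat :: "'a qmat \<Rightarrow> 'a qmat \<Rightarrow> 'a qmat" is "(**)" .

instance
proof
  fix a b c :: "'a qmat"
  show "a * b * c = a * (b * c)" by transfer (simp add: matrix_mul_assoc)
  show "1 * a = a" by transfer simp
  show "a * 1 = a" by transfer simp
  show "(a + b) * c = a * c + b * c"
    by transfer (simp add: matrix_matrix_mult_def vec_eq_iff distrib_right sum.distrib)
  show "a * (b + c) = a * b + a * c"
    by transfer (simp add: matrix_matrix_mult_def vec_eq_iff distrib_left sum.distrib)
  show "(0 :: 'a qmat) \<noteq> 1"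
    by transfer (auto simp: vec_eq_iff mat_def)
qed (transfer, simp)+

end

lift_definition entry :: "'n::finite qmat \<Rightarrow> 'n \<Rightarrow> 'n \<Rightarrow> quat" is "\<lambda>M r s. M $ r $ s" .

lemma qmat_eqI:
  assumes "\<And>r s. entry M r s = entry N r s"
  shows "M = N"
  using assms by transfer (simp add: vec_eq_iff)

lemma entry_simps [simp]:
  "entry 0 r s = 0" "entry 1 r s = (if r = s then 1 else 0)" "entry (M + N) r s = entry M r s + entry N r s"
  "entry (M - N) r s = entry M r s - entry N r s" "entry (- M) r s = - entry M r s"
  by (transfer, simp add: mat_def)+

lemma entry_mult: "entry (M * N) r s = (\<Sum>t\<in>UNIV. entry M r t * entry N t s)"
  by transfer (simp add: matrix_matrix_mult_def)

instantiation qmat :: (finite) real_algebra_1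
begin

lift_definition scaleR_qmat :: "real \<Rightarrow> 'a qmat \<Rightarrow> 'a qmat" is "(*\<^sub>R)" .

lemma entry_scaleR [simp]: "entry (c *\<^sub>R M) r s = c *\<^sub>R entry M r s"
  by transfer simp

instance
  by standard
    (auto intro!: qmat_eqI simp: entry_mult scaleR_sum_right scaleR_add_left scaleR_add_right)

end

lemma entry_sum [simp]: "entry (sum f I) r s = (\<Sum>i\<in>I. entry (f i) r s)"
  by (induction I rule: infinite_finite_induct) auto

lemma bounded_linear_matrix_vector_mult:
  "bounded_linear (\<lambda>x. (M :: quat^'n^'n) *v x)"
  unfolding linear_conv_bounded_linear [symmetric]
  by (rule linearI)
    (simp_all add: matrix_vector_mult_def vec_eq_iff distrib_left sum.distrib scaleR_sum_right)

text \<open>The unit matrix has operator norm one, whereas its Euclidean norm is the square root of the dimension;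
  so the operator norm makes the matrices a unital Banach algebra, with an exponential function.\<close>

instantiation qmat :: (finite) real_normed_algebra_1
begin

lift_definition norm_qmat :: "'a qmat \<Rightarrow> real" is "\<lambda>M. onorm (\<lambda>x. M *v x)" .

definition sgn_qmat_def: "sgn x = x /\<^sub>R norm x" for x :: "'a qmat"

definition dist_qmat_def: "dist x y = norm (x - y)" for x y :: "'a qmat"

definition uniformity_qmat_def [code del]:
  "(uniformity :: ('a qmat \<times> 'a qmat) filter) = (INF e\<in>{0 <..}. principal {(x, y). dist x y < e})"

definition open_qmat_def [code del]:
  "open (U :: 'a qmat set) \<longleftrightarrow> (\<forall>x\<in>U. eventually (\<lambda>(x', y). x' = x \<longrightarrow> y \<in> U) uniformity)"

instance
proof
  fix r :: real and x y :: "'a qmat"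
  show "(norm x = 0) = (x = 0)"
  proof transfer
    fix x :: "quat^'a^'a"
    have "(\<forall>v. x *v v = 0) \<longleftrightarrow> x = 0"
    proof
      assume x: "\<forall>v. x *v v = 0"
      have "x $ r $ s = 0" for r s
      proof -
        have "(x *v axis s 1) $ r = x $ r $ s"
          by (simp add: matrix_vector_mult_def axis_def if_distrib cong: if_cong)
        then show ?thesis using x by simp
      qed
      then show "x = 0" by (simp add: vec_eq_iff)
    qed simp
    then show "(onorm ((*v) x) = 0) = (x = 0)"
      using onorm_eq_0 [OF bounded_linear_matrix_vector_mult] by metis
  qed
  show "norm (x + y) \<le> norm x + norm y"
  proof transfer
    fix x y :: "quat^'a^'a"
    have "(*v) (x + y) = (\<lambda>v. x *v v + y *v v)"
      by (simp add: fun_eq_iff matrix_vector_mult_add_rdistrib)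
    then show "onorm ((*v) (x + y)) \<le> onorm ((*v) x) + onorm ((*v) y)"
      by (simp add: onorm_triangle [OF bounded_linear_matrix_vector_mult bounded_linear_matrix_vector_mult])
  qed
  show "norm (r *\<^sub>R x) = \<bar>r\<bar> * norm x"
  proof transfer
    fix r and x :: "quat^'a^'a"
    have "(\<lambda>v. (r *\<^sub>R x) *v v) = (\<lambda>v. r *\<^sub>R (x *v v))"
      by (simp add: matrix_vector_mult_def vec_eq_iff scaleR_sum_right fun_eq_iff)
    then show "onorm ((*v) (r *\<^sub>R x)) = \<bar>r\<bar> * onorm ((*v) x)"
      by (simp add: onorm_scaleR [OF bounded_linear_matrix_vector_mult])
  qed
  show "norm (x * y) \<le> norm x * norm y"
  proof transfer
    fix x y :: "quat^'a^'a"
    have "(\<lambda>v. (x ** y) *v v) = (*v) x \<circ> (*v) y"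
      by (simp add: fun_eq_iff matrix_vector_mul_assoc)
    then show "onorm ((*v) (x ** y)) \<le> onorm ((*v) x) * onorm ((*v) y)"
      by (simp add: onorm_compose [OF bounded_linear_matrix_vector_mult bounded_linear_matrix_vector_mult])
  qed
  show "norm (1 :: 'a qmat) = 1"
    by transfer (simp add: onorm_id)
qed (rule sgn_qmat_def dist_qmat_def open_qmat_def uniformity_qmat_def)+

end

lemma norm_entry_le: "norm (entry M r s) \<le> norm M"
proof transfer
  fix M :: "quat^'n^'n" and r s
  have "(M *v axis s 1) $ r = M $ r $ s"
    by (simp add: matrix_vector_mult_def axis_def if_distrib cong: if_cong)
  then have "norm (M $ r $ s) \<le> norm (M *v axis s 1)"
    using Finite_Cartesian_Product.norm_nth_le [of "M *v axis s 1" r] by simp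
  also have "\<dots> \<le> onorm ((*v) M) * norm (axis s (1::quat))"
    by (rule onorm [OF bounded_linear_matrix_vector_mult])
  finally show "norm (M $ r $ s) \<le> onorm ((*v) M)"
    by (simp add: norm_vec_def L2_set_def axis_def if_distrib [of norm] if_distrib [of "\<lambda>x. x\<^sup>2"] cong: if_cong)
qed

lemma bounded_linear_entry: "bounded_linear (\<lambda>M. entry M r s)"
  by (rule bounded_linear_intro [of _ 1]) (auto simp: norm_entry_le)

lemma bounded_linear_qmat: "bounded_linear qmat"
  unfolding linear_conv_bounded_linear [symmetric]
  by (rule linearI) (simp_all add: plus_qmat.abs_eq scaleR_qmat.abs_eq eq_onp_same_args)

lemma norm_matrix_le_entries:
  "norm (M :: quat^'n^'n) \<le> (\<Sum>r\<in>UNIV. \<Sum>s\<in>UNIV. norm (M $ r $ s))"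
proof -
  have "norm M \<le> (\<Sum>i\<in>UNIV. norm (M $ i))"
    unfolding norm_vec_def by (rule L2_set_le_sum) simp
  also have "\<dots> \<le> (\<Sum>i\<in>UNIV. \<Sum>j\<in>UNIV. norm (M $ i $ j))"
    unfolding norm_vec_def by (intro sum_mono L2_set_le_sum) simp
  finally show ?thesis .
qed

text \<open>With \<open>bounded_linear_qmat\<close> this says that the operator norm and the Euclidean norm are equivalent.\<close>

lemma bounded_linear_mat_of: "bounded_linear mat_of"
proof (rule bounded_linear_intro)
  show "norm (mat_of M) \<le> norm M * (real CARD('n) * real CARD('n))" for M :: "'n::finite qmat"
  proof -
    have "norm (mat_of M) \<le> (\<Sum>r\<in>(UNIV :: 'n set). \<Sum>s\<in>(UNIV :: 'n set). norm M)"
      using norm_entry_le [of M]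
      by (intro order_trans [OF norm_matrix_le_entries] sum_mono) (simp add: entry.rep_eq)
    then show ?thesis by (simp add: mult_ac)
  qed
qed (simp_all add: plus_qmat.rep_eq scaleR_qmat.rep_eq)

instance qmat :: (finite) banach
proof
  fix X :: "nat \<Rightarrow> 'a qmat"
  assume "Cauchy X"
  then have "Cauchy (\<lambda>n. mat_of (X n))"
    by (rule bounded_linear.Cauchy [OF bounded_linear_mat_of])
  then obtain L where "(\<lambda>n. mat_of (X n)) \<longlonglongrightarrow> L"
    using Cauchy_convergent convergent_def by metis
  then have "(\<lambda>n. qmat (mat_of (X n))) \<longlonglongrightarrow> qmat L"
    by (rule bounded_linear.tendsto [OF bounded_linear_qmat])
  then show "convergent X"
    by (auto simp: convergent_def mat_of_inverse)
qed

lemma tendsto_qmatI: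
  assumes "\<And>r s. ((\<lambda>x. entry (f x) r s) \<longlongrightarrow> entry L r s) F"
  shows "(f \<longlongrightarrow> L) F"
proof -
  have "((\<lambda>x. mat_of (f x)) \<longlongrightarrow> mat_of L) F"
    using assms by (intro vec_tendstoI) (simp add: entry.rep_eq)
  then have "((\<lambda>x. qmat (mat_of (f x))) \<longlongrightarrow> qmat (mat_of L)) F"
    by (rule bounded_linear.tendsto [OF bounded_linear_qmat])
  then show ?thesis by (simp add: mat_of_inverse)
qed

lemma mexp_eq_exp: "mexp X = mat_of (exp (qmat X))"
proof -
  have pow: "mpow X k = mat_of (qmat X ^ k)" for k
    by (induction k) (simp_all add: mpow_def one_qmat.rep_eq times_qmat.rep_eq qmat_inverse)
  have "(\<lambda>k. mat_of (qmat X ^ k /\<^sub>R fact k)) sums mat_of (exp (qmat X))"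
    by (rule bounded_linear.sums [OF bounded_linear_mat_of exp_converges])
  then have "(\<lambda>k. mpow X k /\<^sub>R fact k) sums mat_of (exp (qmat X))"
    by (simp add: pow scaleR_qmat.rep_eq)
  then show ?thesis
    by (rule sums_unique2 [OF mexp_sums])
qed

subsection \<open>Diagonal matrices and matrix units\<close>

lift_definition qdiag :: "('n::finite \<Rightarrow> quat) \<Rightarrow> 'n qmat" is "\<lambda>z. \<chi> r s. if r = s then z r else 0" .

lift_definition qunit :: "'n::finite \<Rightarrow> 'n \<Rightarrow> quat \<Rightarrow> 'n qmat" is
  "\<lambda>k l x. \<chi> r s. if r = k \<and> s = l then x else 0" .

lemma entry_qdiag [simp]: "entry (qdiag z) r s = (if r = s then z r else 0)"
  by transfer simp

lemma entry_qunit [simp]: "entry (qunit k l x) r s = (if r = k \<and> s = l then x else 0)"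
  by transfer simp

lemma entry_qdiag_mult [simp]: "entry (qdiag z * M) r s = z r * entry M r s"
  by (simp add: entry_mult if_distrib [of "\<lambda>x. x * _"] cong: if_cong)

lemma entry_mult_qdiag [simp]: "entry (M * qdiag z) r s = entry M r s * z s"
  by (simp add: entry_mult if_distrib [of "\<lambda>x. _ * x"] cong: if_cong)

lemma entry_qunit_mult [simp]: "entry (qunit k l x * M) r s = (if r = k then x * entry M l s else 0)"
proof -
  have "entry (qunit k l x * M) r s = (\<Sum>t\<in>UNIV. if t = l then (if r = k then x * entry M l s else 0) else 0)"
    unfolding entry_mult by (rule sum.cong) auto
  then show ?thesis by simp
qed

lemma entry_mult_qunit [simp]: "entry (M * qunit k l x) r s = (if s = l then entry M r k * x else 0)"
proof -
  have "entry (M * qunit k l x) r s = (\<Sum>t\<in>UNIV. if t = k then (if s = l then entry M r k * x else 0) else 0)"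
    unfolding entry_mult by (rule sum.cong) auto
  then show ?thesis by simp
qed

lemma qunit_mult: "qunit k l x * qunit k' l' y = (if l = k' then qunit k l' (x * y) else 0)"
  by (rule qmat_eqI) auto

lemma qdiag_power: "qdiag z ^ n = qdiag (\<lambda>r. z r ^ n)"
  by (induction n) (auto intro!: qmat_eqI)

lemma exp_qdiag: "exp (qdiag z) = qdiag (\<lambda>r. exp (z r))"
proof (rule qmat_eqI)
  fix r s
  have "(\<lambda>n. entry (qdiag z ^ n /\<^sub>R fact n) r s) sums entry (exp (qdiag z)) r s"
    by (intro bounded_linear.sums [OF bounded_linear_entry] exp_converges)
  moreover have "(\<lambda>n. entry (qdiag z ^ n /\<^sub>R fact n) r s) sums entry (qdiag (\<lambda>r. exp (z r))) r s"
    using exp_converges [of "z r"] by (cases "r = s") (auto simp: qdiag_power)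
  ultimately show "entry (exp (qdiag z)) r s = entry (qdiag (\<lambda>r. exp (z r))) r s"
    by (rule sums_unique2)
qed

subsection \<open>The exponential of a quaternion\<close>

text \<open>If \<open>u\<^sup>2 = -1\<close>, then \<open>i \<mapsto> u\<close> embeds the complex numbers, and Euler's formula is transported along
  this embedding.\<close>

lemma exp_in_imaginary_plane:
  fixes u :: quat
  assumes u: "u * u = -1"
  shows "exp (a *\<^sub>R 1 + b *\<^sub>R u) = exp a *\<^sub>R (cos b *\<^sub>R 1 + sin b *\<^sub>R u)"
proof -
  define h where "h = (\<lambda>c. Re c *\<^sub>R (1::quat) + Im c *\<^sub>R u)"
  have "bounded_linear h"
    unfolding h_def
    by (intro bounded_linear_add bounded_linear_compose [OF bounded_linear_scaleR_left] bounded_linear_Re bounded_linear_Im)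
  moreover have "h 1 = 1" by (simp add: h_def)
  moreover have "h (x * y) = h x * h y" for x y
  proof -
    have "h x * h y = (Re x * Re y) *\<^sub>R 1 + (Re x * Im y) *\<^sub>R u + (Im x * Re y) *\<^sub>R u + (Im x * Im y) *\<^sub>R (u * u)"
      by (simp add: h_def algebra_simps)
    then show ?thesis
      by (simp add: h_def u algebra_simps)
  qed
  ultimately have "h (exp (Complex a b)) = exp (h (Complex a b))"
    by (rule exp_algebra_hom)
  then show ?thesis
    by (simp add: h_def exp_Complex Re_exp Im_exp scaleR_add_right)
qed

lemma qi_square: "qi * qi = -1"
  by (rule quat_units)

lemma exp_complex_quat: "exp (Quat a b 0 0) = exp a *\<^sub>R Quat (cos b) (sin b) 0 0"
proof -
  have "Quat x y 0 0 = x *\<^sub>R 1 + y *\<^sub>R qi" for x y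
    by (simp add: quat_eq_iff qi_def)
  then show ?thesis using exp_in_imaginary_plane [OF qi_square, of a b] by simp
qed

text \<open>Every quaternion lies in the plane spanned by \<open>1\<close> and an imaginary unit \<open>u\<close>, so it suffices to take
  a complex logarithm in this plane.\<close>

lemma exp_quat_surj:
  fixes q :: quat
  assumes "q \<noteq> 0"
  obtains y where "exp y = q"
proof -
  define v where "v = q - qre q *\<^sub>R 1"
  \<comment> \<open>A real quaternion lies in all these planes; that of \<open>i\<close> is as good as any.\<close>
  define u where "u = (if v = 0 then qi else v /\<^sub>R norm v)"
  have vv: "v * v = - ((norm v)\<^sup>2 *\<^sub>R 1)"
    by (simp add: v_def quat_eq_iff norm_quat_def power2_eq_square)
  have uu: "u * u = -1"
    using vv by (auto simp: u_def qi_square power2_eq_square divide_simps)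
  have q: "q = qre q *\<^sub>R 1 + norm v *\<^sub>R u"
    by (auto simp: u_def) (auto simp: v_def)
  have "(qre q)\<^sup>2 + (norm v)\<^sup>2 = (norm q)\<^sup>2"
    by (simp add: v_def norm_quat_def)
  then have "(qre q / norm q)\<^sup>2 + (norm v / norm q)\<^sup>2 = 1"
    using assms by (simp add: power_divide flip: add_divide_distrib)
  then obtain \<theta> where th: "qre q / norm q = cos \<theta>" "norm v / norm q = sin \<theta>"
    by (rule sincos_total_2pi)
  have "exp (ln (norm q) *\<^sub>R 1 + \<theta> *\<^sub>R u) = norm q *\<^sub>R ((qre q / norm q) *\<^sub>R 1 + (norm v / norm q) *\<^sub>R u)"
    using assms by (simp add: exp_in_imaginary_plane [OF uu] th)
  also have "\<dots> = qre q *\<^sub>R 1 + norm v *\<^sub>R u"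
    using assms by (simp add: scaleR_add_right)
  also have "\<dots> = q" using q by simp
  finally show ?thesis by (rule that)
qed

section \<open>The real determinant of an exponential\<close>

lemma qre_sum: "qre (sum f I) = (\<Sum>i\<in>I. qre (f i))"
  by (induction I rule: infinite_finite_induct) auto

lemma real_matrix_mult: "real_matrix (g ** h) = real_matrix g ** real_matrix h"
proof -
  have "real_matrix (g ** h) *v y = (real_matrix g ** real_matrix h) *v y" for y
    using real_matrix_mult_realify [of "g ** h" "unrealify y"]
      real_matrix_mult_realify [of g "h *v unrealify y"] real_matrix_mult_realify [of h "unrealify y"]
    by (simp add: matrix_vector_mul_assoc [symmetric])
  then show ?thesis by (simp add: matrix_eq)
qed

lemma real_matrix_one: "real_matrix (mat 1 :: quat^'n::finite^'n) = mat 1"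
proof -
  have "real_matrix (mat 1 :: quat^'n^'n) *v y = mat 1 *v y" for y
    using real_matrix_mult_realify [of "mat 1" "unrealify y"] by simp
  then show ?thesis by (simp add: matrix_eq)
qed

lemma linear_real_matrix_entry: "linear (\<lambda>g :: quat^'n^'n. real_matrix g $ p $ q)"
proof -
  have "real_matrix (g + h) *v y = (real_matrix g + real_matrix h) *v y" for g h :: "quat^'n^'n" and y
    using real_matrix_mult_realify [of "g + h" "unrealify y"]
      real_matrix_mult_realify [of g "unrealify y"] real_matrix_mult_realify [of h "unrealify y"]
    by (simp add: matrix_vector_mult_add_rdistrib linear_add [OF linear_realify])
  then have add: "real_matrix (g + h) = real_matrix g + real_matrix h" for g h :: "quat^'n^'n"
    by (simp add: matrix_eq)
  have sc: "(c *\<^sub>R g) *v x = c *\<^sub>R (g *v x)" for c and g :: "quat^'n^'n" and x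
    by (simp add: matrix_vector_mult_def vec_eq_iff scaleR_sum_right)
  have "real_matrix (c *\<^sub>R g) *v y = (c *\<^sub>R real_matrix g) *v y" for c and g :: "quat^'n^'n" and y
    using real_matrix_mult_realify [of "c *\<^sub>R g" "unrealify y"]
      real_matrix_mult_realify [of g "unrealify y"]
    by (simp add: sc linear_scale [OF linear_realify] flip: scaleR_matrix_vector_assoc)
  then have "real_matrix (c *\<^sub>R g) = c *\<^sub>R real_matrix g" for c and g :: "quat^'n^'n"
    by (simp add: matrix_eq)
  with add show ?thesis by (intro linearI) simp_all
qed

text \<open>Each of the four real coordinates of the \<open>r\<close>-th entry contributes the real part of \<open>g $ r $ r\<close>.\<close>

lemma trace_real_matrix:
  fixes g :: "quat^'n::finite^'n"
  shows "trace (real_matrix g) = 4 * qre (trace g)"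
proof -
  have unit: "unrealify (axis (r, c) 1) = axis r (if c = 1 then 1 else if c = 2 then qi else if c = 3 then qj else qk)"
    for r :: 'n and c
    using exhaust_4 [of c]
    by (auto simp: vec_eq_iff unrealify_def axis_def quat_eq_iff qi_def qj_def qk_def)
  have col: "(g *v axis r x) $ r = g $ r $ r * x" for r x
    by (simp add: matrix_vector_mult_def axis_def if_distrib [of "\<lambda>x. _ * x"] cong: if_cong)
  have "real_matrix g $ (r, c) $ (r, c) = qre (g $ r $ r)" for r and c :: 4
    using exhaust_4 [of c]
    by (auto simp: real_matrix_def matrix_def unit col realify_def vector_4_nth qi_def qj_def qk_def)
  then have "real_matrix g $ p $ p = qre (g $ fst p $ fst p)" for p
    by (cases p) simp
  then have "trace (real_matrix g) = (\<Sum>p\<in>(UNIV :: 'n set) \<times> (UNIV :: 4 set). qre (g $ fst p $ fst p))"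
    by (simp add: trace_def)
  also have "\<dots> = (\<Sum>r\<in>UNIV. \<Sum>c\<in>(UNIV :: 4 set). qre (g $ r $ r))"
    by (subst sum.cartesian_product) (simp add: case_prod_beta)
  also have "\<dots> = 4 * (\<Sum>r\<in>UNIV. qre (g $ r $ r))"
    by (simp add: sum_distrib_left)
  also have "(\<Sum>r\<in>UNIV. qre (g $ r $ r)) = qre (trace g)"
    by (simp add: trace_def qre_sum)
  finally show ?thesis .
qed

text \<open>In the Leibniz formula a permutation other than the identity moves at least two points; each
  term of the derivative of its product then still contains an off-diagonal entry of the unit matrix.\<close>

lemma det_derivative_at_one:
  fixes M :: "real \<Rightarrow> real^'n^'n"
  assumes M0: "M 0 = mat 1"
    and M: "\<And>i j. ((\<lambda>t. M t $ i $ j) has_field_derivative D $ i $ j) (at 0)"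
  shows "((\<lambda>t. det (M t)) has_field_derivative trace D) (at 0)"
proof -
  define d where "d = (\<lambda>p. \<Sum>i\<in>UNIV. D $ i $ p i * (\<Prod>j\<in>UNIV - {i}. M 0 $ j $ p j))"
  have d: "((\<lambda>t. \<Prod>i\<in>UNIV. M t $ i $ p i) has_field_derivative d p) (at 0)" for p
    unfolding d_def by (intro has_field_derivative_prod M)
  have "((\<lambda>t. det (M t)) has_field_derivative (\<Sum>p | p permutes UNIV. of_int (sign p) * d p)) (at 0)"
    unfolding det_def by (intro DERIV_sum DERIV_cmult d)
  also have "(\<Sum>p | p permutes UNIV. of_int (sign p) * d p) = (\<Sum>p\<in>{id}. of_int (sign p) * d p)"
  proof (rule sum.mono_neutral_right)
    show "finite {p. p permutes (UNIV :: 'n set)}" by (simp add: finite_permutations)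
    show "{id} \<subseteq> {p. p permutes (UNIV :: 'n set)}" by (simp add: permutes_id)
    show "\<forall>p\<in>{p. p permutes (UNIV :: 'n set)} - {id}. of_int (sign p) * d p = 0"
    proof
      fix p assume "p \<in> {p. p permutes (UNIV :: 'n set)} - {id}"
      then have p: "inj p" "p \<noteq> id" by (auto simp: permutes_inj)
      have zero: "D $ i $ p i * (\<Prod>j\<in>UNIV - {i}. M 0 $ j $ p j) = 0" for i
      proof -
        have "\<exists>j. j \<noteq> i \<and> p j \<noteq> j"
        proof (rule ccontr)
          assume "\<not> (\<exists>j. j \<noteq> i \<and> p j \<noteq> j)"
          then have fixed: "p j = j" if "j \<noteq> i" for j using that by blast
          have "p i = i"
            using fixed [of "p i"] p(1) by (metis injD)
          then have "p = id" using fixed by (intro ext) (metis id_apply)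
          with p(2) show False by simp
        qed
        then obtain j where "j \<noteq> i" "p j \<noteq> j" by blast
        then have "(\<Prod>j\<in>UNIV - {i}. M 0 $ j $ p j) = 0"
          by (intro prod_zero bexI [of _ j]) (auto simp: M0 mat_def)
        then show ?thesis by simp
      qed
      have "d p = 0" unfolding d_def by (simp only: zero sum.neutral_const)
      then show "of_int (sign p) * d p = 0" by simp
    qed
  qed
  also have "\<dots> = trace D"
    by (simp add: d_def M0 mat_def trace_def)
  finally show ?thesis .
qed

text \<open>The real determinant and the real part of the trace, which define the special linear group and
  its Lie algebra.\<close>

definition sdet :: "'n::finite qmat \<Rightarrow> real" where
  "sdet M = det (real_matrix (mat_of M))"

definition rtrace :: "'n::finite qmat \<Rightarrow> real" where
  "rtrace M = qre (trace (mat_of M))"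

lemma sdet_one: "sdet 1 = 1"
  by (simp add: sdet_def one_qmat.rep_eq real_matrix_one)

lemma sdet_mult: "sdet (M * N) = sdet M * sdet N"
  by (simp add: sdet_def times_qmat.rep_eq real_matrix_mult det_mul)

lemma rtrace_eq_sum: "rtrace M = (\<Sum>r\<in>UNIV. qre (entry M r r))"
  by (simp add: rtrace_def trace_def entry.rep_eq qre_sum)

lemma linear_rtrace: "linear rtrace"
  by (rule linearI) (simp_all add: rtrace_eq_sum sum.distrib sum_distrib_left)

text \<open>The function \<open>t \<mapsto> sdet (exp (t X))\<close> turns sums into products, and its derivative at \<open>0\<close> is the trace of the
  real matrix of \<open>X\<close>.\<close>

lemma sdet_exp: "sdet (exp X) = exp (4 * rtrace X)"
proof -
  define f where "f = (\<lambda>t. sdet (exp (t *\<^sub>R X)))"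
  define \<tau> where "\<tau> = 4 * rtrace X"
  have f_add: "f (t + s) = f t * f s" for t s
    by (simp add: f_def scaleR_add_left exp_add_commuting sdet_mult)
  have f0: "f 0 = 1" by (simp add: f_def sdet_one)
  have "((\<lambda>t. real_matrix (mat_of (exp (t *\<^sub>R X))) $ p $ q) has_field_derivative real_matrix (mat_of X) $ p $ q) (at 0)"
    for p q
  proof -
    have "bounded_linear (\<lambda>g :: quat^'a^'a. real_matrix g $ p $ q)"
      using linear_real_matrix_entry linear_conv_bounded_linear by blast
    then have bl: "bounded_linear (\<lambda>M. real_matrix (mat_of M) $ p $ q)"
      using bounded_linear_compose [OF _ bounded_linear_mat_of] by blast
    show ?thesis
      using bounded_linear.has_vector_derivative [OF bl exp_curve_derivative, of X]
      by (simp add: has_real_derivative_iff_has_vector_derivative)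
  qed
  then have "((\<lambda>t. f t) has_field_derivative \<tau>) (at 0)"
    unfolding f_def sdet_def \<tau>_def rtrace_def trace_real_matrix [symmetric]
    by (intro det_derivative_at_one) (simp_all add: one_qmat.rep_eq real_matrix_one)
  then have d0: "(f has_field_derivative \<tau>) (at 0)" by simp
  have df: "(f has_field_derivative f t * \<tau>) (at t)" for t
  proof -
    have "((\<lambda>s. f t * f (s - t)) has_field_derivative f t * \<tau>) (at t)"
      using d0 DERIV_shift [of f \<tau> t "- t"] by (intro DERIV_cmult) simp
    moreover have "f t * f (s - t) = f s" for s
      using f_add [of t "s - t"] by simp
    ultimately show ?thesis by simp
  qed
  have "((\<lambda>t. f t * exp (- \<tau> * t)) has_field_derivative 0) (at t)" for t
    by (rule derivative_eq_intros df refl | simp)+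
  then have "f 1 * exp (- \<tau> * 1) = f 0 * exp (- \<tau> * 0)"
    by (intro DERIV_isconst_all) simp
  then have "f 1 = exp \<tau>"
    by (simp add: f0 exp_minus field_simps)
  then show ?thesis by (simp add: f_def \<tau>_def)
qed

section \<open>A neighbourhood of the identity\<close>

text \<open>Near \<open>0\<close> the map \<open>F\<close> differs little from the identity. A continuous \<open>G\<close> close to \<open>F\<close> is then close to the
  identity as well, and a fixed point of \<open>y \<mapsto> x + (y - G y)\<close>, which exists by Brouwer's theorem, solves \<open>G y = x\<close>.
  Thus \<open>G\<close> may be any continuous approximation with values in a prescribed set.\<close>

lemma stable_local_surjectivity:
  fixes F :: "'p::euclidean_space \<Rightarrow> 'p"
  assumes F: "(F has_derivative (\<lambda>z. z)) (at 0)" and F0: "F 0 = 0"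
  obtains \<delta> \<eta> where "\<delta> > 0" "\<eta> > 0"
    "\<And>G x. continuous_on (cball 0 \<delta>) G \<Longrightarrow> (\<forall>z\<in>cball 0 \<delta>. norm (G z - F z) < \<eta>) \<Longrightarrow>
      norm x \<le> \<eta> \<Longrightarrow> \<exists>z\<in>cball 0 \<delta>. G z = x"
proof -
  have "\<exists>d>0. \<forall>y. norm (y - 0) < d \<longrightarrow> norm (F y - F 0 - (y - 0)) \<le> 1/4 * norm (y - 0)"
    using F unfolding has_derivative_at_alt by (elim conjE allE [of _ "1/4"]) simp
  then obtain d where d: "d > 0" "\<And>y. norm y < d \<Longrightarrow> norm (F y - y) \<le> norm y / 4"
    using F0 by auto
  define \<delta> where "\<delta> = d / 2"
  have del: "\<delta> > 0" "\<delta> < d" using d by (auto simp: \<delta>_def)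
  show thesis
  proof
    show "\<delta> > 0" "\<delta> / 4 > 0" using del by auto
    fix G and x :: 'p
    assume G: "continuous_on (cball 0 \<delta>) G" "\<forall>z\<in>cball 0 \<delta>. norm (G z - F z) < \<delta> / 4"
      and x: "norm x \<le> \<delta> / 4"
    have "x + (y - G y) \<in> cball 0 \<delta>" if y: "y \<in> cball 0 \<delta>" for y
    proof -
      have "norm (F y - y) \<le> \<delta> / 4"
        using d(2) [of y] y del by auto
      moreover have "norm (G y - F y) < \<delta> / 4" using G(2) y by simp
      moreover have "norm (x + (y - G y)) \<le> norm x + norm (F y - y) + norm (G y - F y)"
      proof -
        have eq: "x + (y - G y) = x - (F y - y) - (G y - F y)" by simp
        show ?thesis
          unfolding eq
          using norm_triangle_ineq4 [of "x - (F y - y)" "G y - F y"] norm_triangle_ineq4 [of x "F y - y"]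
          by linarith
      qed
      ultimately have "norm (x + (y - G y)) \<le> \<delta> / 4 + \<delta> / 4 + \<delta> / 4"
        using \<open>norm x \<le> \<delta> / 4\<close> by linarith
      then show ?thesis using del by simp
    qed
    then show "\<exists>z\<in>cball 0 \<delta>. G z = x"
      using brouwer_surjective_cball [OF G(1) del(1), of x "{x}"] by blast
  qed
qed

text \<open>Negative parameters are reached by a shift: \<open>exp (s X) = exp ((s + R) X) exp (- R X)\<close>, where \<open>R\<close> bounds
  \<open>s = z \<bullet> b\<close> on the compact set \<open>K\<close>.\<close>

lemma approximable_exp_edge:
  fixes b :: "'p::euclidean_space"
  assumes S: "\<And>x y. x \<in> S \<Longrightarrow> y \<in> S \<Longrightarrow> x * y \<in> S"
    and X: "X \<in> lie_edge S" and K: "compact K"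
  shows "approximable K S (\<lambda>z. exp ((z \<bullet> b) *\<^sub>R X))"
proof -
  have "bounded ((\<lambda>z. z \<bullet> b) ` K)"
    by (intro compact_imp_bounded compact_continuous_image continuous_intros K)
  then obtain R where R: "\<And>z. z \<in> K \<Longrightarrow> \<bar>z \<bullet> b\<bar> \<le> R" and R0: "R > 0"
    unfolding bounded_pos by auto
  have "approximable {0..2 * R} S (\<lambda>t. exp (t *\<^sub>R X))"
    using X R0 by (auto simp: lie_edge_def lie_saturate_def)
  moreover have "(\<lambda>z. z \<bullet> b + R) ` K \<subseteq> {0..2 * R}"
    using R by (fastforce simp: abs_le_iff)
  ultimately have a: "approximable K S (\<lambda>z. exp ((z \<bullet> b + R) *\<^sub>R X))"
    by (intro approximable_compose [where h = "\<lambda>z. z \<bullet> b + R"] continuous_intros)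
  have "approximable {0..R} S (\<lambda>t. exp (t *\<^sub>R (- X)))"
    using X R0 by (auto simp: lie_edge_def lie_saturate_def)
  then have b: "approximable K S (\<lambda>z. exp (R *\<^sub>R (- X)))"
    using R0 by (intro approximable_compose [where h = "\<lambda>z. R"] continuous_intros) auto
  have "bounded ((\<lambda>z. exp ((z \<bullet> b + R) *\<^sub>R X)) ` K)"
    by (intro compact_imp_bounded compact_continuous_image K
        continuous_on_compose2 [OF continuous_on_exp_curve [of UNIV]] continuous_intros) auto
  moreover have "bounded ((\<lambda>z::'p. exp (R *\<^sub>R (- X))) ` K)"
    by (simp add: image_constant_conv)
  ultimately have "approximable K S (\<lambda>z. exp ((z \<bullet> b + R) *\<^sub>R X) * exp (R *\<^sub>R (- X)))"
    by (intro approximable_mult S a b)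
  moreover have "exp ((z \<bullet> b + R) *\<^sub>R X) * exp (R *\<^sub>R (- X)) = exp ((z \<bullet> b) *\<^sub>R X)" for z
  proof -
    have "exp ((z \<bullet> b + R) *\<^sub>R X + R *\<^sub>R (- X)) = exp ((z \<bullet> b + R) *\<^sub>R X) * exp (R *\<^sub>R (- X))"
      by (rule exp_add_commuting) simp
    then show ?thesis by (simp add: scaleR_add_left)
  qed
  ultimately show ?thesis by simp
qed

text \<open>Coordinates of the second kind: \<open>\<Phi> z\<close> is the product, in some order, of the factors \<open>exp ((z \<bullet> b) X b)\<close>
  over \<open>b \<in> I\<close>.\<close>

lemma approximable_coordinates:
  fixes X :: "'p::euclidean_space \<Rightarrow> 'a::{real_normed_algebra_1,banach}"
  assumes S: "\<And>x y. x \<in> S \<Longrightarrow> y \<in> S \<Longrightarrow> x * y \<in> S"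
    and zero: "0 \<in> lie_saturate S"
    and "finite I" "\<And>b. b \<in> I \<Longrightarrow> X b \<in> lie_edge S"
  shows "\<exists>\<Phi>. \<Phi> 0 = 1 \<and> (\<Phi> has_derivative (\<lambda>z. \<Sum>b\<in>I. (z \<bullet> b) *\<^sub>R X b)) (at 0) \<and>
    (\<forall>K. compact K \<longrightarrow> continuous_on K \<Phi> \<and> approximable K S \<Phi>)"
  using assms(3,4)
proof (induction I rule: finite_induct)
  case empty
  have "approximable K S (\<lambda>z. 1)" for K :: "'p set"
  proof -
    have "approximable {0..0} S (\<lambda>t. exp (t *\<^sub>R 0))"
      using zero unfolding lie_saturate_def by blast
    then have "approximable K S (\<lambda>z. exp (0 *\<^sub>R 0))"
      by (rule approximable_compose [where h = "\<lambda>z. 0"]) auto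
    then show ?thesis by simp
  qed
  then show ?case by (intro exI [of _ "\<lambda>z. 1"]) auto
next
  case (insert b I)
  then obtain \<Phi> where Phi: "\<Phi> 0 = 1" "(\<Phi> has_derivative (\<lambda>z. \<Sum>b\<in>I. (z \<bullet> b) *\<^sub>R X b)) (at 0)"
    and K: "\<And>K. compact K \<Longrightarrow> continuous_on K \<Phi>" "\<And>K. compact K \<Longrightarrow> approximable K S \<Phi>"
    by auto
  have ce: "continuous_on K (\<lambda>z. exp ((z \<bullet> b) *\<^sub>R X b))" for K
    by (intro continuous_on_compose2 [OF continuous_on_exp_curve [of UNIV]] continuous_intros) auto
  have "((\<lambda>s. exp (s *\<^sub>R X b)) has_derivative (\<lambda>s. s *\<^sub>R X b)) (at (0 \<bullet> b))"
    using exp_curve_derivative [of "X b"] by (simp add: has_vector_derivative_def)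
  then have "((\<lambda>s. exp (s *\<^sub>R X b)) \<circ> (\<lambda>z. z \<bullet> b) has_derivative (\<lambda>s. s *\<^sub>R X b) \<circ> (\<lambda>z. z \<bullet> b)) (at 0)"
    by (intro diff_chain_at bounded_linear_imp_has_derivative bounded_linear_inner_left)
  then have "((\<lambda>z. exp ((z \<bullet> b) *\<^sub>R X b)) has_derivative (\<lambda>z. (z \<bullet> b) *\<^sub>R X b)) (at 0)"
    by (simp add: o_def)
  from has_derivative_mult [OF this Phi(2)]
  have der: "((\<lambda>z. exp ((z \<bullet> b) *\<^sub>R X b) * \<Phi> z) has_derivative
      (\<lambda>z. \<Sum>b\<in>insert b I. (z \<bullet> b) *\<^sub>R X b)) (at 0)"
    using insert.hyps by (simp add: Phi(1) add.commute)
  have "continuous_on K (\<lambda>z. exp ((z \<bullet> b) *\<^sub>R X b) * \<Phi> z) \<and>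
      approximable K S (\<lambda>z. exp ((z \<bullet> b) *\<^sub>R X b) * \<Phi> z)" if "compact K" for K
    using insert.prems that
    by (intro conjI approximable_mult S approximable_exp_edge continuous_on_mult ce K
        compact_imp_bounded compact_continuous_image) auto
  then show ?case
    using der Phi(1) by (intro exI [of _ "\<lambda>z. exp ((z \<bullet> b) *\<^sub>R X b) * \<Phi> z"]) auto
qed

text \<open>\<open>Sl(n, H)\<close> has codimension one among the matrices, whereas the surjectivity lemma works in the full matrix
  space. The missing direction is supplied by a positive scalar factor \<open>exp (c z)\<close>. Every matrix near
  the identity is then a positive multiple of an element of \<open>S\<close>, and for a matrix of determinant \<open>1\<close> this multiple is
  trivial.\<close>

lemma semigroup_covers_neighbourhood:
  fixes S :: "'n::finite qmat set"
  assumes S: "\<And>x y. x \<in> S \<Longrightarrow> y \<in> S \<Longrightarrow> x * y \<in> S"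
    and det: "\<And>x. x \<in> S \<Longrightarrow> sdet x = 1"
    and edge: "\<And>X. rtrace X = 0 \<Longrightarrow> X \<in> lie_edge S"
  obtains \<epsilon> where "\<epsilon> > 0" "\<And>g. sdet g = 1 \<Longrightarrow> norm (g - 1) < \<epsilon> \<Longrightarrow> g \<in> S"
proof -
  \<comment> \<open>\<open>c z\<close> is the coefficient of the identity in the splitting of \<open>z\<close> into a multiple of the identity and a part of trace
    zero, and \<open>X b\<close> is the trace-zero part of a standard basis element; no basis of \<open>sl(n, H)\<close> has to be
    chosen.\<close>
  define c where "c = (\<lambda>z :: quat^'n^'n. rtrace (qmat z) / real CARD('n))"
  define X where "X = (\<lambda>b. qmat b - c b *\<^sub>R 1)"
  have rt1: "rtrace (1 :: 'n qmat) = real CARD('n)"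
    by (simp add: rtrace_eq_sum)
  have lin_c: "linear c"
    by (intro linearI)
      (simp_all add: c_def add_divide_distrib linear_simps(1,5) [OF bounded_linear_qmat]
        linear_add [OF linear_rtrace] linear_scale [OF linear_rtrace])
  have bl_c: "bounded_linear c"
    using lin_c linear_conv_bounded_linear by blast
  have "X b \<in> lie_edge S" for b
  proof (rule edge)
    have "rtrace (X b) = rtrace (qmat b) - c b * rtrace (1 :: 'n qmat)"
      unfolding X_def by (simp add: linear_diff [OF linear_rtrace] linear_scale [OF linear_rtrace])
    then show "rtrace (X b) = 0" by (simp add: c_def rt1)
  qed
  moreover have "(0 :: 'n qmat) \<in> lie_saturate S"
    using edge [of 0] lie_edge_subset by (auto simp: rtrace_eq_sum)
  ultimately obtain \<Phi> where Phi: "\<Phi> 0 = 1"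
      "(\<Phi> has_derivative (\<lambda>z. \<Sum>b\<in>Basis. (z \<bullet> b) *\<^sub>R X b)) (at 0)"
      "\<And>K. compact K \<Longrightarrow> approximable K S \<Phi>"
    using approximable_coordinates [OF S, of Basis X] by auto
  have lin_q: "linear qmat" by (rule bounded_linear.linear [OF bounded_linear_qmat])
  have sumX: "(\<Sum>b\<in>Basis. (z \<bullet> b) *\<^sub>R X b) = qmat z - c z *\<^sub>R 1" for z
  proof -
    have "qmat z = (\<Sum>b\<in>Basis. (z \<bullet> b) *\<^sub>R qmat b)"
      by (subst euclidean_representation [symmetric]) (simp only: linear_sum [OF lin_q] linear_scale [OF lin_q])
    moreover have "c z = (\<Sum>b\<in>Basis. (z \<bullet> b) *\<^sub>R c b)"
      by (subst euclidean_representation [symmetric]) (simp only: linear_sum [OF lin_c] linear_scale [OF lin_c])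
    ultimately show ?thesis
      by (simp add: X_def scaleR_diff_right sum_subtractf scaleR_sum_left)
  qed
  have c0: "c 0 = 0" by (rule linear_0 [OF lin_c])
  have "((\<lambda>z. exp (c z)) has_derivative (\<lambda>z. c z)) (at 0)"
    using has_derivative_exp [OF bounded_linear_imp_has_derivative [OF bl_c], of 0 UNIV] c0 by simp
  from has_derivative_scaleR [OF this Phi(2)]
  have "((\<lambda>z. exp (c z) *\<^sub>R \<Phi> z) has_derivative (\<lambda>z. qmat z)) (at 0)"
    by (simp add: sumX Phi(1) c0)
  then have "((\<lambda>z. exp (c z) *\<^sub>R \<Phi> z - 1) has_derivative (\<lambda>z. qmat z - 0)) (at 0)"
    by (intro has_derivative_diff has_derivative_const)
  from bounded_linear.has_derivative [OF bounded_linear_mat_of this]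
  have "((\<lambda>z. mat_of (exp (c z) *\<^sub>R \<Phi> z - 1)) has_derivative (\<lambda>z. z)) (at 0)"
    by (simp add: qmat_inverse)
  then obtain \<delta> \<eta> where de: "\<delta> > 0" "\<eta> > 0" and surj:
    "\<And>G x. continuous_on (cball 0 \<delta>) G \<Longrightarrow>
      (\<forall>z\<in>cball 0 \<delta>. norm (G z - mat_of (exp (c z) *\<^sub>R \<Phi> z - 1)) < \<eta>) \<Longrightarrow>
      norm x \<le> \<eta> \<Longrightarrow> \<exists>z\<in>cball 0 \<delta>. G z = x"
    by (rule stable_local_surjectivity) (auto simp: Phi(1) c0 zero_qmat.rep_eq)
  obtain C where C: "C > 0" "\<And>M :: 'n qmat. norm (mat_of M) \<le> norm M * C"
    using bounded_linear.pos_bounded [OF bounded_linear_mat_of] by blast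
  have "bounded ((\<lambda>z. exp (c z)) ` cball 0 \<delta>)"
    by (intro compact_imp_bounded compact_continuous_image compact_cball continuous_intros
        linear_continuous_on bl_c)
  then obtain E where E: "E > 0" "\<And>z. z \<in> cball 0 \<delta> \<Longrightarrow> exp (c z) \<le> E"
    unfolding bounded_pos by auto
  have "\<eta> / (E * C) > 0" using de E C by simp
  then obtain \<sigma> where sig: "continuous_on (cball 0 \<delta>) \<sigma>" "\<sigma> ` cball 0 \<delta> \<subseteq> S"
      "\<forall>z\<in>cball 0 \<delta>. norm (\<sigma> z - \<Phi> z) < \<eta> / (E * C)"
    using Phi(3) [OF compact_cball] unfolding approximable_def by meson
  define G where "G = (\<lambda>z. mat_of (exp (c z) *\<^sub>R \<sigma> z - 1))"
  have contG: "continuous_on (cball 0 \<delta>) G"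
    unfolding G_def
    by (intro bounded_linear.continuous_on [OF bounded_linear_mat_of] continuous_intros
        linear_continuous_on bl_c sig)
  have closeG: "\<forall>z\<in>cball 0 \<delta>. norm (G z - mat_of (exp (c z) *\<^sub>R \<Phi> z - 1)) < \<eta>"
  proof
    fix z :: "quat^'n^'n" assume z: "z \<in> cball 0 \<delta>"
    have "G z - mat_of (exp (c z) *\<^sub>R \<Phi> z - 1) = mat_of (exp (c z) *\<^sub>R (\<sigma> z - \<Phi> z))"
      by (simp add: G_def minus_qmat.rep_eq scaleR_qmat.rep_eq scaleR_diff_right)
    then have "norm (G z - mat_of (exp (c z) *\<^sub>R \<Phi> z - 1)) \<le> norm (exp (c z) *\<^sub>R (\<sigma> z - \<Phi> z)) * C"
      using C(2) by metis
    also have "\<dots> \<le> E * norm (\<sigma> z - \<Phi> z) * C"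
      using E(2) [OF z] C(1) by (simp add: mult_right_mono)
    also have "\<dots> = norm (\<sigma> z - \<Phi> z) * (E * C)" by simp
    also have "\<dots> < \<eta>"
      using bspec [OF sig(3) z] E(1) C(1) by (simp add: pos_less_divide_eq)
    finally show "norm (G z - mat_of (exp (c z) *\<^sub>R \<Phi> z - 1)) < \<eta>" .
  qed
  show thesis
  proof
    show "\<eta> / C > 0" using de C by simp
    fix g :: "'n qmat" assume g: "sdet g = 1" "norm (g - 1) < \<eta> / C"
    have "norm (mat_of (g - 1)) \<le> norm (g - 1) * C" by (rule C)
    also have "\<dots> \<le> \<eta>" using g(2) C(1) by (simp add: field_simps)
    finally obtain z where z: "z \<in> cball 0 \<delta>" "G z = mat_of (g - 1)"
      using surj [OF contG closeG] by blast
    then have "exp (c z) *\<^sub>R \<sigma> z - 1 = g - 1"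
      by (simp add: G_def mat_of_inject)
    then have gz: "g = exp (c z) *\<^sub>R \<sigma> z" by simp
    also have "\<dots> = exp (c z *\<^sub>R 1) * \<sigma> z"
      by (simp add: exp_of_real flip: of_real_def) (simp add: of_real_def)
    finally have "sdet g = exp (4 * (c z * real CARD('n))) * sdet (\<sigma> z)"
      by (simp add: sdet_mult sdet_exp linear_scale [OF linear_rtrace] rt1)
    then have "c z = 0"
      using det [of "\<sigma> z"] sig(2) z(1) g(1) by (auto simp: image_subset_iff)
    then show "g \<in> S" using gz sig(2) z(1) by auto
  qed
qed

text \<open>\<open>exp X\<close> is a power of \<open>exp (X / n)\<close>, which is close to the identity for large \<open>n\<close>.\<close>

lemma semigroup_contains_exponentials:
  fixes S :: "'n::finite qmat set"
  assumes S: "\<And>x y. x \<in> S \<Longrightarrow> y \<in> S \<Longrightarrow> x * y \<in> S"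
    and det: "\<And>x. x \<in> S \<Longrightarrow> sdet x = 1"
    and edge: "\<And>X. rtrace X = 0 \<Longrightarrow> X \<in> lie_edge S"
    and X: "rtrace X = 0"
  shows "exp X \<in> S"
proof -
  obtain \<epsilon> where eps: "\<epsilon> > 0" "\<And>g. sdet g = 1 \<Longrightarrow> norm (g - 1) < \<epsilon> \<Longrightarrow> g \<in> S"
    using semigroup_covers_neighbourhood [OF S det edge] by metis
  have "isCont (\<lambda>s. exp (s *\<^sub>R X)) 0"
    using continuous_on_exp_curve [of UNIV X] by (simp add: continuous_on_eq_continuous_at)
  then obtain d where d: "d > 0" "\<And>s. \<bar>s\<bar> < d \<Longrightarrow> norm (exp (s *\<^sub>R X) - 1) < \<epsilon>"
    using eps(1) unfolding continuous_at_eps_delta by (auto simp: dist_norm)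
  obtain n where n: "inverse (real (Suc n)) < d"
    using reals_Archimedean [OF d(1)] by blast
  define g where "g = exp (inverse (real (Suc n)) *\<^sub>R X)"
  have "g \<in> S"
    unfolding g_def using n
    by (intro eps(2) d(2)) (auto simp: sdet_exp linear_scale [OF linear_rtrace] X)
  then have pow: "g ^ Suc k \<in> S" for k
    by (induction k) (auto intro: S)
  have "g ^ Suc n = exp X"
    unfolding g_def by (simp add: exp_power_scaleR del: power_Suc of_nat_Suc)
  then show ?thesis using pow by metis
qed

section \<open>The special linear group is generated by exponentials\<close>

inductive_set exp_group :: "'n::finite qmat set" where
  one: "1 \<in> exp_group"
| exp_mult: "rtrace X = 0 \<Longrightarrow> h \<in> exp_group \<Longrightarrow> exp X * h \<in> exp_group"

lemma exp_group_exp: "rtrace X = 0 \<Longrightarrow> exp X \<in> exp_group"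
  using exp_group.exp_mult [OF _ exp_group.one, of X] by simp

lemma exp_group_mult:
  assumes "g \<in> exp_group" "h \<in> exp_group"
  shows "g * h \<in> exp_group"
  using assms by (induction g rule: exp_group.induct) (auto simp: mult.assoc intro: exp_group.exp_mult)

lemma exp_group_inverse:
  assumes "g \<in> exp_group"
  shows "\<exists>h\<in>exp_group. h * g = 1 \<and> g * h = 1"
  using assms
proof (induction g rule: exp_group.induct)
  case one
  show ?case by (intro bexI [of _ 1] exp_group.one) auto
next
  case (exp_mult X g)
  then obtain h where h: "h \<in> exp_group" "h * g = 1" "g * h = 1" by blast
  have "rtrace (- X) = 0"
    using exp_mult.hyps(1) by (simp add: linear_neg [OF linear_rtrace])
  then have "h * exp (- X) \<in> exp_group"
    by (intro exp_group_mult exp_group_exp h)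
  moreover have "h * exp (- X) * (exp X * g) = 1"
    using h(2) by (metis exp_minus_mult(1) mult.assoc mult_1_left)
  moreover have "exp X * g * (h * exp (- X)) = 1"
    using h(3) by (metis exp_minus_mult(2) mult.assoc mult_1_left)
  ultimately show ?case by blast
qed

lemma sdet_exp_group: "g \<in> exp_group \<Longrightarrow> sdet g = 1"
  by (induction g rule: exp_group.induct) (simp_all add: sdet_one sdet_mult sdet_exp)

text \<open>Off-diagonal matrices concentrated in the column \<open>c\<close>. They square to zero, and \<open>1 + qcol c y\<close> acts from
  the left by adding \<open>y r\<close> times the row \<open>c\<close> to each other row \<open>r\<close>.\<close>

lift_definition qcol :: "'n::finite \<Rightarrow> ('n \<Rightarrow> quat) \<Rightarrow> 'n qmat" is
  "\<lambda>c y. \<chi> r s. if s = c \<and> r \<noteq> c then y r else 0" .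

lemma entry_qcol [simp]: "entry (qcol c y) r s = (if s = c \<and> r \<noteq> c then y r else 0)"
  by transfer simp

lemma entry_qcol_mult [simp]: "entry (qcol c y * M) r s = (if r \<noteq> c then y r * entry M c s else 0)"
proof -
  have "entry (qcol c y * M) r s = (\<Sum>t\<in>UNIV. if t = c then (if r \<noteq> c then y r * entry M c s else 0) else 0)"
    unfolding entry_mult by (rule sum.cong) auto
  then show ?thesis by simp
qed

lemma exp_qcol: "exp (qcol c y) = 1 + qcol c y"
  by (rule exp_square_zero) (auto intro: qmat_eqI)

lemma entry_row_operation:
  "entry (exp (qcol c y) * M) r s = entry M r s + (if r \<noteq> c then y r * entry M c s else 0)"
  by (simp add: exp_qcol distrib_right)

lemma row_operation_in_exp_group: "exp (qcol c y) \<in> exp_group"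
  by (rule exp_group_exp) (simp add: rtrace_eq_sum)

definition unit_columns :: "'n::finite set \<Rightarrow> 'n qmat \<Rightarrow> bool" where
  "unit_columns F M \<longleftrightarrow> (\<forall>c\<in>F. \<forall>r. entry M r c = (if r = c then 1 else 0))"

text \<open>Otherwise the column \<open>c\<close> would be a combination of the unit columns in \<open>F\<close>; the matrix \<open>W\<close> of the proof
  encodes this linear relation, and \<open>M * W = 0\<close> contradicts invertibility.\<close>

lemma nonzero_pivot:
  assumes inv: "N * M = 1" and F: "unit_columns F M" and c: "c \<notin> F"
  shows "\<exists>i. i \<notin> F \<and> entry M i c \<noteq> 0"
proof (rule ccontr)
  assume "\<not> ?thesis"
  then have zero: "entry M i c = 0" if "i \<notin> F" for i
    using that by blast
  \<comment> \<open>The column \<open>c\<close> of \<open>W\<close> holds the coefficients of the relation; its entries outside \<open>F\<close> vanish, except for the \<open>1\<close> at \<open>c\<close>.\<close>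
  define W where "W = qunit c c 1 - qcol c (\<lambda>r. entry M r c)"
  have "M * W = 0"
  proof (rule qmat_eqI)
    fix r s
    have "entry (M * W) r s = 0" if s: "s = c"
    proof -
      have "entry M r t * entry W t c = (if t = c then entry M r c else 0) -
          (if t = r then (if r \<in> F then entry M r c else 0) else 0)" for t
        using F c zero [of t] unfolding unit_columns_def W_def by (cases "t \<in> F") auto
      then have "entry (M * W) r c = entry M r c - (if r \<in> F then entry M r c else 0)"
        unfolding entry_mult by (simp add: sum_subtractf)
      then show ?thesis using zero [of r] s by auto
    qed
    moreover have "entry (M * W) r s = 0" if "s \<noteq> c"
      unfolding entry_mult using that by (intro sum.neutral) (auto simp: W_def)
    ultimately show "entry (M * W) r s = entry 0 r s" by auto
  qed
  then have "W = 0"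
    using inv by (metis mult.assoc mult_1_left mult_zero_right)
  then have "entry W c c = 0" by simp
  then show False by (simp add: W_def)
qed

lemma unit_columns_row_operation:
  assumes "unit_columns F M" "c \<notin> F"
  shows "unit_columns F (exp (qcol c y) * M)"
  using assms unfolding unit_columns_def entry_row_operation by auto

text \<open>A row with a nonzero entry in the column \<open>c\<close>, other than the row \<open>c\<close> itself, can be used to turn the pivot into
  \<open>1\<close> without scaling a row. If no such row exists, the row \<open>d\<close>, which is still free, first receives a copy of
  the row \<open>c\<close>. This is why a second index outside \<open>F\<close> is required.\<close>

lemma normalise_pivot:
  assumes M: "N * M = 1" "unit_columns F M" and c: "c \<notin> F" and d: "d \<notin> F" "d \<noteq> c"
  shows "\<exists>h\<in>exp_group. unit_columns F (h * M) \<and> entry (h * M) c c = 1"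
proof -
  have step: ?thesis if h: "h \<in> exp_group" "unit_columns F (h * M)" and i: "i \<notin> F" "i \<noteq> c" "entry (h * M) i c \<noteq> 0" for h i
  proof -
    define e where "e = exp (qcol i (\<lambda>r. if r = c then (1 - entry (h * M) c c) * inverse (entry (h * M) i c) else 0))"
    have "e * h \<in> exp_group"
      unfolding e_def by (intro exp_group_mult row_operation_in_exp_group h)
    moreover have "unit_columns F (e * h * M)"
      unfolding e_def mult.assoc by (intro unit_columns_row_operation h i)
    moreover have "entry (e * h * M) c c = 1"
      unfolding e_def mult.assoc entry_row_operation using i by (simp add: mult.assoc)
    ultimately show ?thesis by blast
  qed
  obtain i where i: "i \<notin> F" "entry M i c \<noteq> 0"
    using nonzero_pivot [OF M c] by blast
  show ?thesis
  proof (cases "i = c")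
    case False
    then show ?thesis using step [of 1 i] i M by (simp add: exp_group.one)
  next
    case True
    show ?thesis
    proof (cases "entry M d c = 0")
      case False
      then show ?thesis using step [of 1 d] d M by (simp add: exp_group.one)
    next
      case zero: True
      show ?thesis
      proof (rule step)
        show "exp (qcol c (\<lambda>r. if r = d then 1 else 0)) \<in> exp_group"
          by (rule row_operation_in_exp_group)
        show "unit_columns F (exp (qcol c (\<lambda>r. if r = d then 1 else 0)) * M)"
          by (intro unit_columns_row_operation M c)
        show "entry (exp (qcol c (\<lambda>r. if r = d then 1 else 0)) * M) d c \<noteq> 0"
          unfolding entry_row_operation using d zero i True by simp
      qed (use d in auto)
    qed
  qed
qed

lemma row_reduction:
  assumes M: "N * M = 1" and "F \<noteq> UNIV"
  shows "\<exists>h\<in>exp_group. unit_columns F (h * M)"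
  using finite [of F] assms(2)
proof (induction F rule: finite_induct)
  case empty
  show ?case by (intro bexI [of _ 1] exp_group.one) (simp add: unit_columns_def)
next
  case (insert c F)
  then obtain d where d: "d \<notin> F" "d \<noteq> c" by auto
  have "F \<noteq> UNIV" using insert.hyps by auto
  then obtain h where h: "h \<in> exp_group" "unit_columns F (h * M)"
    using insert.IH by blast
  obtain h' where h': "h' * h = 1"
    using exp_group_inverse [OF h(1)] by blast
  have "N * h' * (h * M) = 1"
    using M h' by (metis mult.assoc mult_1_left)
  then obtain k where k: "k \<in> exp_group" "unit_columns F (k * (h * M))" "entry (k * (h * M)) c c = 1"
    using normalise_pivot [of "N * h'" "h * M" F c d] h(2) insert.hyps(2) d by blast
  define e where "e = exp (qcol c (\<lambda>r. - entry (k * (h * M)) r c))"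
  have "e * k * h \<in> exp_group"
    unfolding e_def by (intro exp_group_mult row_operation_in_exp_group k h)
  moreover have "unit_columns F (e * (k * (h * M)))"
    unfolding e_def by (intro unit_columns_row_operation k insert.hyps)
  moreover have "entry (e * (k * (h * M))) r c = (if r = c then 1 else 0)" for r
    unfolding e_def entry_row_operation using k(3) by simp
  ultimately have "unit_columns (insert c F) (e * k * h * M)"
    unfolding unit_columns_def by (simp add: mult.assoc)
  with \<open>e * k * h \<in> exp_group\<close> show ?case by blast
qed

text \<open>Row reduction stops when a single column remains. Clearing that column
  leaves a diagonal matrix with one diagonal entry \<open>q \<noteq> 0\<close> and all others equal to \<open>1\<close>. It is the exponential of a diagonal matrix,
  and the determinant forces the trace of the latter to have real part zero.\<close>

lemma special_linear_subset_exp_group: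
  assumes M: "N * M = 1" and det: "sdet M = 1"
  shows "M \<in> exp_group"
proof -
  define c where "c = (undefined :: 'a)"
  obtain h where h: "h \<in> exp_group" "unit_columns (- {c}) (h * M)"
    using row_reduction [OF M, of "- {c}"] by auto
  obtain h' where h': "h' \<in> exp_group" "h' * h = 1"
    using exp_group_inverse [OF h(1)] by blast
  have inv: "N * h' * (h * M) = 1"
    using M h' by (metis mult.assoc mult_1_left)
  define q where "q = entry (h * M) c c"
  have q: "q \<noteq> 0"
    using nonzero_pivot [OF inv h(2), of c] by (auto simp: q_def)
  define e where "e = exp (qcol c (\<lambda>r. - entry (h * M) r c * inverse q))"
  have e: "e * h \<in> exp_group"
    unfolding e_def by (intro exp_group_mult row_operation_in_exp_group h)
  obtain y where y: "exp y = q" using exp_quat_surj [OF q] .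
  define Y where "Y = qdiag (\<lambda>r. if r = c then y else 0)"
  have "e * h * M = exp Y"
  proof (rule qmat_eqI)
    fix r s
    have u: "entry (e * (h * M)) r s = (if r = s then 1 else 0)" if "s \<noteq> c"
      using unit_columns_row_operation [OF h(2), of c] that
      unfolding e_def unit_columns_def by auto
    have v: "entry (e * (h * M)) r c = (if r = c then q else 0)"
      unfolding e_def entry_row_operation using q by (simp add: mult.assoc flip: q_def)
    show "entry (e * h * M) r s = entry (exp Y) r s"
      using u v y by (cases "s = c") (auto simp: Y_def exp_qdiag mult.assoc)
  qed
  moreover have "sdet (e * h * M) = 1"
    using sdet_exp_group [OF e] det by (simp add: sdet_mult)
  ultimately have "rtrace Y = 0"
    by (simp add: sdet_exp)
  then have "e * h * M \<in> exp_group"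
    using \<open>e * h * M = exp Y\<close> exp_group_exp by metis
  moreover obtain k where "k \<in> exp_group" "k * (e * h) = 1"
    using exp_group_inverse [OF e] by blast
  ultimately show ?thesis
    using exp_group_mult by (metis mult.assoc mult_1_left)
qed

lemma exp_group_subset:
  fixes S :: "'n::finite qmat set"
  assumes "\<And>x y. x \<in> S \<Longrightarrow> y \<in> S \<Longrightarrow> x * y \<in> S" and exp: "\<And>X. rtrace X = 0 \<Longrightarrow> exp X \<in> S"
  shows "exp_group \<subseteq> S"
proof
  fix g :: "'n qmat" assume "g \<in> exp_group"
  then show "g \<in> S"
  proof (induction g rule: exp_group.induct)
    case one
    show ?case using exp [of 0] by (simp add: rtrace_eq_sum)
  qed (use assms in blast)
qed

section \<open>Cones invariant under rotations\<close>

text \<open>The quarter turns of a nonzero vector are \<open>\<plusminus>\<close> the vectors of an orthogonal basis of the plane, and so their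
  nonnegative combinations already fill the plane.\<close>

lemma rotation_invariant_cone_plane:
  fixes P :: "real \<Rightarrow> real \<Rightarrow> bool"
  assumes add: "\<And>u v u' v'. P u v \<Longrightarrow> P u' v' \<Longrightarrow> P (u + u') (v + v')"
    and scale: "\<And>r u v. r \<ge> 0 \<Longrightarrow> P u v \<Longrightarrow> P (r * u) (r * v)"
    and rot: "\<And>s u v. P u v \<Longrightarrow> P (cos s * u - sin s * v) (sin s * u + cos s * v)"
    and P0: "P u0 v0" and nz: "u0\<^sup>2 + v0\<^sup>2 \<noteq> 0"
  shows "P u v"
proof -
  have P1: "P (- v0) u0" using rot [OF P0, of "pi / 2"] by simp
  have P2: "P (- u0) (- v0)" using rot [OF P0, of pi] by simp
  have P3: "P v0 (- u0)" using rot [OF P0, of "- (pi / 2)"] by simp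
  have a: "P (a * u0) (a * v0)" for a
    using scale [OF _ P0, of a] scale [OF _ P2, of "- a"] by (cases "a \<ge> 0") auto
  have b: "P (b * (- v0)) (b * u0)" for b
    using scale [OF _ P1, of b] scale [OF _ P3, of "- b"] by (cases "b \<ge> 0") auto
  define N where "N = u0\<^sup>2 + v0\<^sup>2"
  have N: "N \<noteq> 0" using nz by (simp add: N_def)
  define x where "x = (u * u0 + v * v0) / N"
  define y where "y = (v * u0 - u * v0) / N"
  have "P (x * u0 + y * (- v0)) (x * v0 + y * u0)"
    by (intro add a b)
  moreover have "x * u0 + y * (- v0) = u * (u0\<^sup>2 + v0\<^sup>2) / N" "x * v0 + y * u0 = v * (u0\<^sup>2 + v0\<^sup>2) / N"
    unfolding x_def y_def by (simp_all add: field_simps power2_eq_square add_divide_distrib diff_divide_distrib)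
  ultimately show ?thesis using N by (simp flip: N_def)
qed

text \<open>Multiplication by unit complex numbers from both sides. On the plane spanned by \<open>1, i\<close> it is the
  rotation by \<open>\<theta> - \<phi>\<close>, on the plane spanned by \<open>j, k\<close> the rotation by \<open>\<theta> + \<phi>\<close>.\<close>

definition qrot :: "real \<Rightarrow> real \<Rightarrow> quat \<Rightarrow> quat" where
  "qrot \<theta> \<phi> x = Quat (cos \<theta>) (sin \<theta>) 0 0 * x * Quat (cos \<phi>) (- sin \<phi>) 0 0"

lemma qrot_sel:
  "qre (qrot \<theta> \<phi> x) = cos (\<theta> - \<phi>) * qre x - sin (\<theta> - \<phi>) * qim1 x"
  "qim1 (qrot \<theta> \<phi> x) = sin (\<theta> - \<phi>) * qre x + cos (\<theta> - \<phi>) * qim1 x"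
  "qim2 (qrot \<theta> \<phi> x) = cos (\<theta> + \<phi>) * qim2 x - sin (\<theta> + \<phi>) * qim3 x"
  "qim3 (qrot \<theta> \<phi> x) = sin (\<theta> + \<phi>) * qim2 x + cos (\<theta> + \<phi>) * qim3 x"
  by (simp_all add: qrot_def cos_add sin_add cos_diff sin_diff algebra_simps)

text \<open>The squared lengths of the components in the two planes, spanned by \<open>1, i\<close> and by \<open>j, k\<close>.\<close>

definition sqnorm_1i :: "quat \<Rightarrow> real" where "sqnorm_1i x = (qre x)\<^sup>2 + (qim1 x)\<^sup>2"
definition sqnorm_jk :: "quat \<Rightarrow> real" where "sqnorm_jk x = (qim2 x)\<^sup>2 + (qim3 x)\<^sup>2"

lemma rotation_norm:
  fixes u v :: real
  shows "(cos s * u - sin s * v)\<^sup>2 + (sin s * u + cos s * v)\<^sup>2 = u\<^sup>2 + v\<^sup>2"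
proof -
  have "(cos s * u - sin s * v)\<^sup>2 + (sin s * u + cos s * v)\<^sup>2 = ((cos s)\<^sup>2 + (sin s)\<^sup>2) * (u\<^sup>2 + v\<^sup>2)"
    by algebra
  then show ?thesis by simp
qed

lemma rotation_sum_norm:
  fixes u v :: real
  shows "(u + (cos s * u - sin s * v))\<^sup>2 + (v + (sin s * u + cos s * v))\<^sup>2 = (2 + 2 * cos s) * (u\<^sup>2 + v\<^sup>2)"
proof -
  have "(sin s)\<^sup>2 = 1 - (cos s)\<^sup>2" by (simp add: sin_squared_eq)
  then show ?thesis by algebra
qed

lemma sqnorm_qrot: "sqnorm_1i (qrot \<theta> \<phi> x) = sqnorm_1i x" "sqnorm_jk (qrot \<theta> \<phi> x) = sqnorm_jk x"
  by (simp_all add: sqnorm_1i_def sqnorm_jk_def qrot_sel rotation_norm)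

lemma cos_ratio_not_minus_one:
  assumes "a \<noteq> 0" "b / a \<notin> \<rat>"
  shows "cos (pi / a * b) \<noteq> -1"
proof
  assume "cos (pi / a * b) = -1"
  then obtain m :: int where "pi / a * b = (2 * m + 1) * pi"
    unfolding cos_eq_minus1 by auto
  then have "pi * (b / a) = pi * of_int (2 * m + 1)" by (simp add: mult.commute)
  then have "b / a = of_int (2 * m + 1)"
    using mult_left_cancel [OF pi_neq_zero] by blast
  then show False using assms(2) by simp
qed

text \<open>The planes rotate with the speeds \<open>\<beta> - \<gamma>\<close> and \<open>\<beta> + \<gamma>\<close>. After half a turn of one plane, adding the rotated
  element to the original one cancels its component in this plane. The component in the other plane survives, because
  its angle is not an odd multiple of \<open>\<pi>\<close> when the ratio of the speeds is irrational. So the cone meets each of the planes in a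
  nonzero vector, and contains each plane.\<close>

lemma rotation_invariant_cone_quat:
  fixes C :: "quat set" and \<beta> \<gamma> :: real
  assumes add: "\<And>x y. x \<in> C \<Longrightarrow> y \<in> C \<Longrightarrow> x + y \<in> C"
    and scale: "\<And>r x. r \<ge> 0 \<Longrightarrow> x \<in> C \<Longrightarrow> r *\<^sub>R x \<in> C"
    and rot: "\<And>t x. x \<in> C \<Longrightarrow> qrot (t * \<beta>) (t * \<gamma>) x \<in> C"
    and x: "x \<in> C" "sqnorm_1i x \<noteq> 0" "sqnorm_jk x \<noteq> 0"
    and \<mu>: "\<beta> - \<gamma> \<noteq> 0" "\<beta> + \<gamma> \<noteq> 0" "(\<beta> + \<gamma>) / (\<beta> - \<gamma>) \<notin> \<rat>"
  shows "y \<in> C"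
proof -
  let ?m = "\<beta> - \<gamma>" and ?n = "\<beta> + \<gamma>"
  have rat: "?m / ?n \<notin> \<rat>"
    using \<mu>(3) Rats_inverse [of "?m / ?n"] by (auto simp: inverse_eq_divide)
  have angle: "t * \<beta> - t * \<gamma> = t * ?m" "t * \<beta> + t * \<gamma> = t * ?n" for t
    by (simp_all add: algebra_simps)
  have plane2: "Quat 0 0 u v \<in> C" for u v
  proof (rule rotation_invariant_cone_plane [where P = "\<lambda>u v. Quat 0 0 u v \<in> C"])
    fix u v u' v' assume "Quat 0 0 u v \<in> C" "Quat 0 0 u' v' \<in> C"
    moreover have "Quat 0 0 (u + u') (v + v') = Quat 0 0 u v + Quat 0 0 u' v'" by (simp add: quat_eq_iff)
    ultimately show "Quat 0 0 (u + u') (v + v') \<in> C" by (simp add: add)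
  next
    fix r u v :: real assume "r \<ge> 0" "Quat 0 0 u v \<in> C"
    moreover have "Quat 0 0 (r * u) (r * v) = r *\<^sub>R Quat 0 0 u v" by (simp add: quat_eq_iff)
    ultimately show "Quat 0 0 (r * u) (r * v) \<in> C" by (simp add: scale)
  next
    fix s u v assume P: "Quat 0 0 u v \<in> C"
    have eq: "Quat 0 0 (cos s * u - sin s * v) (sin s * u + cos s * v) = qrot (s / ?n * \<beta>) (s / ?n * \<gamma>) (Quat 0 0 u v)"
      unfolding quat_eq_iff qrot_sel angle using \<mu>(2) by simp
    show "Quat 0 0 (cos s * u - sin s * v) (sin s * u + cos s * v) \<in> C"
      unfolding eq by (rule rot [OF P])
  next
    define w where "w = x + qrot (pi / ?m * \<beta>) (pi / ?m * \<gamma>) x"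
    have "w \<in> C" unfolding w_def by (intro add rot x)
    moreover have "w = Quat 0 0 (qim2 w) (qim3 w)"
      unfolding quat_eq_iff w_def plus_quat.sel qrot_sel angle using \<mu>(1) by simp
    ultimately show "Quat 0 0 (qim2 w) (qim3 w) \<in> C" by simp
    have "(qim2 w)\<^sup>2 + (qim3 w)\<^sup>2 = (2 + 2 * cos (pi / ?m * ?n)) * sqnorm_jk x"
      unfolding w_def plus_quat.sel qrot_sel angle sqnorm_jk_def by (rule rotation_sum_norm)
    then show "(qim2 w)\<^sup>2 + (qim3 w)\<^sup>2 \<noteq> 0"
      using cos_ratio_not_minus_one [OF \<mu>(1,3)] x(3) by (simp add: add_eq_0_iff)
  qed
  have plane1: "Quat u v 0 0 \<in> C" for u v
  proof (rule rotation_invariant_cone_plane [where P = "\<lambda>u v. Quat u v 0 0 \<in> C"])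
    fix u v u' v' assume "Quat u v 0 0 \<in> C" "Quat u' v' 0 0 \<in> C"
    moreover have "Quat (u + u') (v + v') 0 0 = Quat u v 0 0 + Quat u' v' 0 0" by (simp add: quat_eq_iff)
    ultimately show "Quat (u + u') (v + v') 0 0 \<in> C" by (simp add: add)
  next
    fix r u v :: real assume "r \<ge> 0" "Quat u v 0 0 \<in> C"
    moreover have "Quat (r * u) (r * v) 0 0 = r *\<^sub>R Quat u v 0 0" by (simp add: quat_eq_iff)
    ultimately show "Quat (r * u) (r * v) 0 0 \<in> C" by (simp add: scale)
  next
    fix s u v assume P: "Quat u v 0 0 \<in> C"
    have eq: "Quat (cos s * u - sin s * v) (sin s * u + cos s * v) 0 0 = qrot (s / ?m * \<beta>) (s / ?m * \<gamma>) (Quat u v 0 0)"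
      unfolding quat_eq_iff qrot_sel angle using \<mu>(1) by simp
    show "Quat (cos s * u - sin s * v) (sin s * u + cos s * v) 0 0 \<in> C"
      unfolding eq by (rule rot [OF P])
  next
    define w where "w = x + qrot (pi / ?n * \<beta>) (pi / ?n * \<gamma>) x"
    have "w \<in> C" unfolding w_def by (intro add rot x)
    moreover have "w = Quat (qre w) (qim1 w) 0 0"
      unfolding quat_eq_iff w_def plus_quat.sel qrot_sel angle using \<mu>(2) by simp
    ultimately show "Quat (qre w) (qim1 w) 0 0 \<in> C" by simp
    have "(qre w)\<^sup>2 + (qim1 w)\<^sup>2 = (2 + 2 * cos (pi / ?n * ?m)) * sqnorm_1i x"
      unfolding w_def plus_quat.sel qrot_sel angle sqnorm_1i_def by (rule rotation_sum_norm)
    then show "(qre w)\<^sup>2 + (qim1 w)\<^sup>2 \<noteq> 0"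
      using cos_ratio_not_minus_one [OF \<mu>(2) rat] x(2) by (simp add: add_eq_0_iff)
  qed
  have "y = Quat (qre y) (qim1 y) 0 0 + Quat 0 0 (qim2 y) (qim3 y)"
    by (simp add: quat_eq_iff)
  then show ?thesis using add [OF plane1 plane2] by metis
qed

section \<open>The extremal root space\<close>

lemma qunit_add: "qunit k l (x + y) = qunit k l x + qunit k l y"
  by (rule qmat_eqI) auto

lemma qunit_scale: "qunit k l (r *\<^sub>R x) = r *\<^sub>R qunit k l x"
  by (rule qmat_eqI) auto

lemma qunit_minus: "qunit k l (- x) = - qunit k l x"
  by (rule qmat_eqI) auto

lemma entry_conjugate_exp_qdiag:
  "entry (exp (t *\<^sub>R qdiag z) * M * exp (t *\<^sub>R (- qdiag z))) r s = exp (t *\<^sub>R z r) * entry M r s * exp (- t *\<^sub>R z s)"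
proof -
  have "t *\<^sub>R qdiag z = qdiag (\<lambda>r. t *\<^sub>R z r)" "t *\<^sub>R (- qdiag z) = qdiag (\<lambda>r. - t *\<^sub>R z r)"
    by (auto intro!: qmat_eqI)
  then show ?thesis by (simp add: exp_qdiag)
qed

lemma exp_conjugate_entry_complex:
  "exp (t *\<^sub>R Quat a b 0 0) * x * exp (- t *\<^sub>R Quat c d 0 0) = exp (t * (a - c)) *\<^sub>R qrot (t * b) (t * d) x"
proof -
  have s: "t *\<^sub>R Quat a b 0 0 = Quat (t * a) (t * b) 0 0" "- t *\<^sub>R Quat c d 0 0 = Quat (- (t * c)) (- (t * d)) 0 0"
    by (simp_all add: quat_eq_iff)
  have "exp (t * (a - c)) = exp (t * a) * exp (- (t * c))"
    by (simp add: right_diff_distrib flip: exp_add)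
  then show ?thesis
    unfolding s exp_complex_quat by (simp add: qrot_def)
qed

lemma norm_qrot: "norm (qrot \<theta> \<phi> x) = norm x"
  unfolding norm_quat_def using sqnorm_qrot [of \<theta> \<phi> x] by (simp add: sqnorm_1i_def sqnorm_jk_def)

lemma tendsto_quat_sel:
  assumes "(f \<longlongrightarrow> x) F"
  shows "((\<lambda>n. qre (f n)) \<longlongrightarrow> qre x) F" "((\<lambda>n. qim1 (f n)) \<longlongrightarrow> qim1 x) F"
    "((\<lambda>n. qim2 (f n)) \<longlongrightarrow> qim2 x) F" "((\<lambda>n. qim3 (f n)) \<longlongrightarrow> qim3 x) F"
proof -
  have "qre z = inner z 1" "qim1 z = inner z qi" "qim2 z = inner z qj" "qim3 z = inner z qk" for z
    by (simp_all add: inner_quat_def qi_def qj_def qk_def)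
  then show "((\<lambda>n. qre (f n)) \<longlongrightarrow> qre x) F" "((\<lambda>n. qim1 (f n)) \<longlongrightarrow> qim1 x) F"
    "((\<lambda>n. qim2 (f n)) \<longlongrightarrow> qim2 x) F" "((\<lambda>n. qim3 (f n)) \<longlongrightarrow> qim3 x) F"
    by (simp_all add: assms tendsto_inner)
qed

text \<open>Rescaling by the growth rate of the corner entry makes the other entries of the conjugates of
  \<open>A\<close> decay exponentially, while the corner entry is only rotated. It stays in a compact set, and rotations
  preserve the lengths of both components; hence a subsequence converges to the required corner matrix.\<close>

lemma extremal_direction:
  fixes \<alpha> \<beta> :: "'n::finite \<Rightarrow> real"
  assumes S: "\<And>x y. x \<in> S \<Longrightarrow> y \<in> S \<Longrightarrow> x * y \<in> S"
    and A: "A \<in> lie_saturate S" and B: "qdiag (\<lambda>r. Quat (\<alpha> r) (\<beta> r) 0 0) \<in> lie_edge S"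
    and dom: "\<And>r s. (r, s) \<noteq> (k, l) \<Longrightarrow> \<alpha> r - \<alpha> s < \<alpha> k - \<alpha> l"
  obtains x where "qunit k l x \<in> lie_saturate S" "sqnorm_1i x = sqnorm_1i (entry A k l)" "sqnorm_jk x = sqnorm_jk (entry A k l)"
proof -
  let ?B = "qdiag (\<lambda>r. Quat (\<alpha> r) (\<beta> r) 0 0)" and ?p = "entry A k l"
  have sub: "subspace (lie_edge S)"
    using subspace_lie_edge [OF S] A by auto
  define Y where "Y = (\<lambda>t. exp (- t * (\<alpha> k - \<alpha> l)) *\<^sub>R (exp (t *\<^sub>R ?B) * A * exp (t *\<^sub>R (- ?B))))"
  have Y: "Y t \<in> lie_saturate S" for t
    unfolding Y_def
    using lie_saturate_conjugate [OF S A, of "t *\<^sub>R ?B"] subspace_scale [OF sub B, of t]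
    by (intro lie_saturate_scale) auto
  have entryY: "entry (Y t) r s = exp (t * ((\<alpha> r - \<alpha> s) - (\<alpha> k - \<alpha> l))) *\<^sub>R qrot (t * \<beta> r) (t * \<beta> s) (entry A r s)" for t r s
    unfolding Y_def entry_scaleR entry_conjugate_exp_qdiag exp_conjugate_entry_complex
    by (simp add: algebra_simps flip: exp_add)
  define x where "x = (\<lambda>n::nat. qrot (n * \<beta> k) (n * \<beta> l) ?p)"
  have "bounded (range x)"
    unfolding bounded_iff by (auto simp: x_def norm_qrot)
  then obtain x0 \<sigma> where \<sigma>: "strict_mono \<sigma>" and x0: "(x \<circ> \<sigma>) \<longlonglongrightarrow> x0"
    using bounded_imp_convergent_subsequence by blast
  have lim: "(\<lambda>n. entry (Y (real (\<sigma> n))) r s) \<longlonglongrightarrow> entry (qunit k l x0) r s" for r s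
  proof (cases "(r, s) = (k, l)")
    case True
    then show ?thesis using x0 by (simp add: entryY x_def o_def)
  next
    case False
    define c where "c = (\<alpha> k - \<alpha> l) - (\<alpha> r - \<alpha> s)"
    have c: "c > 0" using dom [OF False] by (simp add: c_def)
    have "filterlim (\<lambda>n. real (\<sigma> n)) at_top sequentially"
      using filterlim_compose [OF filterlim_real_sequentially filterlim_subseq [OF \<sigma>]] .
    then have "filterlim (\<lambda>n. - c * real (\<sigma> n)) at_bot sequentially"
      using c by (intro filterlim_tendsto_neg_mult_at_bot [OF tendsto_const]) auto
    then have "(\<lambda>n. exp (- c * real (\<sigma> n))) \<longlonglongrightarrow> 0"
      by (rule filterlim_compose [OF exp_at_bot])
    then have "(\<lambda>n. exp (- c * real (\<sigma> n)) * norm (entry A r s)) \<longlonglongrightarrow> 0"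
      by (rule tendsto_mult_left_zero)
    then have "(\<lambda>n. norm (entry (Y (real (\<sigma> n))) r s)) \<longlonglongrightarrow> 0"
      by (simp add: entryY norm_qrot c_def algebra_simps)
    then have "(\<lambda>n. entry (Y (real (\<sigma> n))) r s) \<longlonglongrightarrow> 0"
      by (rule tendsto_norm_zero_cancel)
    then show ?thesis using False by auto
  qed
  show thesis
  proof
    have "(\<lambda>n. Y (real (\<sigma> n))) \<longlonglongrightarrow> qunit k l x0"
      by (intro tendsto_qmatI lim)
    then show "qunit k l x0 \<in> lie_saturate S"
      by (rule closed_sequentially [OF closed_lie_saturate Y])
    have "(\<lambda>n. sqnorm_1i ((x \<circ> \<sigma>) n)) \<longlonglongrightarrow> sqnorm_1i x0" "(\<lambda>n. sqnorm_jk ((x \<circ> \<sigma>) n)) \<longlonglongrightarrow> sqnorm_jk x0"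
      unfolding sqnorm_1i_def sqnorm_jk_def by (intro tendsto_intros tendsto_quat_sel x0)+
    then show "sqnorm_1i x0 = sqnorm_1i ?p" "sqnorm_jk x0 = sqnorm_jk ?p"
      by (simp_all add: x_def sqnorm_qrot LIMSEQ_const_iff)
  qed
qed

text \<open>The corner matrices in the Lie saturate form a convex cone of quaternions, which conjugation by \<open>exp (t B)\<close> rotates.\<close>

lemma extremal_root_space:
  fixes \<alpha> \<beta> :: "'n::finite \<Rightarrow> real"
  assumes S: "\<And>x y. x \<in> S \<Longrightarrow> y \<in> S \<Longrightarrow> x * y \<in> S"
    and A: "A \<in> lie_saturate S" and B: "qdiag (\<lambda>r. Quat (\<alpha> r) (\<beta> r) 0 0) \<in> lie_edge S"
    and dom: "\<And>r s. (r, s) \<noteq> (k, l) \<Longrightarrow> \<alpha> r - \<alpha> s < \<alpha> k - \<alpha> l"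
    and p: "sqnorm_1i (entry A k l) \<noteq> 0" "sqnorm_jk (entry A k l) \<noteq> 0"
    and \<mu>: "\<beta> k - \<beta> l \<noteq> 0" "\<beta> k + \<beta> l \<noteq> 0" "(\<beta> k + \<beta> l) / (\<beta> k - \<beta> l) \<notin> \<rat>"
  shows "qunit k l y \<in> lie_edge S"
proof -
  let ?B = "qdiag (\<lambda>r. Quat (\<alpha> r) (\<beta> r) 0 0)"
  have sub: "subspace (lie_edge S)"
    using subspace_lie_edge [OF S] A by auto
  obtain x where x: "qunit k l x \<in> lie_saturate S" "sqnorm_1i x \<noteq> 0" "sqnorm_jk x \<noteq> 0"
    using extremal_direction [OF S A B dom] p by metis
  have "y \<in> {x. qunit k l x \<in> lie_saturate S}" for y
  proof (rule rotation_invariant_cone_quat [OF _ _ _ _ _ _ \<mu>])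
    fix t x assume x: "x \<in> {x. qunit k l x \<in> lie_saturate S}"
    have "exp (t *\<^sub>R ?B) * qunit k l x * exp (t *\<^sub>R (- ?B)) \<in> lie_saturate S"
      using lie_saturate_conjugate [OF S, of "qunit k l x" "t *\<^sub>R ?B"] subspace_scale [OF sub B, of t] x by auto
    then have "exp (- t * (\<alpha> k - \<alpha> l)) *\<^sub>R (exp (t *\<^sub>R ?B) * qunit k l x * exp (t *\<^sub>R (- ?B))) \<in> lie_saturate S"
      by (intro lie_saturate_scale) auto
    moreover have "exp (- t * (\<alpha> k - \<alpha> l)) *\<^sub>R (exp (t *\<^sub>R ?B) * qunit k l x * exp (t *\<^sub>R (- ?B)))
        = qunit k l (qrot (t * \<beta> k) (t * \<beta> l) x)"
      by (rule qmat_eqI, unfold entry_scaleR entry_conjugate_exp_qdiag exp_conjugate_entry_complex)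
        (auto simp: qrot_def simp flip: exp_add)
    ultimately show "qrot (t * \<beta> k) (t * \<beta> l) x \<in> {x. qunit k l x \<in> lie_saturate S}"
      by simp
  next
    fix x y assume "x \<in> {x. qunit k l x \<in> lie_saturate S}" "y \<in> {x. qunit k l x \<in> lie_saturate S}"
    then show "x + y \<in> {x. qunit k l x \<in> lie_saturate S}"
      by (simp add: qunit_add lie_saturate_add [OF S])
  qed (use x in \<open>simp_all add: qunit_scale lie_saturate_scale\<close>)
  then show ?thesis
    by (simp add: lie_edge_def flip: qunit_minus)
qed

section \<open>Weights relative to two indices\<close>

text \<open>The weights of the diagonal matrix \<open>E\<^sub>k\<^sub>k - E\<^sub>l\<^sub>l\<close>. They are real rather than integral because they
  appear as growth rates. The component of weight \<open>\<mu>\<close> of a matrix is its part in the eigenspace of the bracket with this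
  diagonal matrix for the eigenvalue \<open>\<mu>\<close>.\<close>

definition wt :: "'n \<Rightarrow> 'n \<Rightarrow> 'n \<Rightarrow> real" where
  "wt k l r = (if r = k then 1 else if r = l then -1 else 0)"

lift_definition weight_part :: "'n::finite \<Rightarrow> 'n \<Rightarrow> real \<Rightarrow> 'n qmat \<Rightarrow> 'n qmat" is
  "\<lambda>k l \<mu> M. \<chi> r s. if wt k l r - wt k l s = \<mu> then M $ r $ s else 0" .

lemma entry_weight_part [simp]:
  "entry (weight_part k l \<mu> M) r s = (if wt k l r - wt k l s = \<mu> then entry M r s else 0)"
  by transfer simp

lemma weight_part_swap: "k \<noteq> l \<Longrightarrow> weight_part l k \<mu> M = weight_part k l (- \<mu>) M"
  by (rule qmat_eqI) (auto simp: wt_def)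

lemma weight_part_2: "k \<noteq> l \<Longrightarrow> weight_part k l 2 M = qunit k l (entry M k l)"
  by (rule qmat_eqI) (auto simp: wt_def)

lemma weight_part_idem: "weight_part k l \<mu> (weight_part k l \<mu> M) = weight_part k l \<mu> M"
  by (rule qmat_eqI) auto

lemma weight_decomposition:
  "M = weight_part k l (-2) M + weight_part k l (-1) M + weight_part k l 0 M + weight_part k l 1 M + weight_part k l 2 M"
  by (rule qmat_eqI) (auto simp: wt_def)

lemma linear_weight_part: "linear (weight_part k l \<mu>)"
  by (rule linearI) (auto intro!: qmat_eqI)

lemma bounded_linear_weight_part: "bounded_linear (weight_part k l \<mu>)"
proof -
  have "linear (\<lambda>M. weight_part k l \<mu> (qmat M))"
    using linear_compose [OF bounded_linear.linear [OF bounded_linear_qmat] linear_weight_part]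
    by (simp add: o_def)
  then have "bounded_linear (\<lambda>M. weight_part k l \<mu> (qmat M))"
    by (simp add: linear_conv_bounded_linear)
  from bounded_linear_compose [OF this bounded_linear_mat_of] show ?thesis
    by (simp add: mat_of_inverse)
qed

lemma weight_part_mult_left:
  assumes "weight_part k l \<mu> X = X"
  shows "weight_part k l \<nu> (X * M) = X * weight_part k l (\<nu> - \<mu>) M"
proof (rule qmat_eqI)
  fix r s
  have X: "entry X r t = 0" if "wt k l r - wt k l t \<noteq> \<mu>" for t
    using arg_cong [OF assms, of "\<lambda>Y. entry Y r t"] that by simp
  have "entry X r t * (if wt k l t - wt k l s = \<nu> - \<mu> then entry M t s else 0)
      = (if wt k l r - wt k l s = \<nu> then entry X r t * entry M t s else 0)" for t
    by (cases "wt k l r - wt k l t = \<mu>") (auto simp: X)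
  then show "entry (weight_part k l \<nu> (X * M)) r s = entry (X * weight_part k l (\<nu> - \<mu>) M) r s"
    by (simp add: entry_mult)
qed

lemma weight_part_mult_right:
  assumes "weight_part k l \<mu> X = X"
  shows "weight_part k l \<nu> (M * X) = weight_part k l (\<nu> - \<mu>) M * X"
proof (rule qmat_eqI)
  fix r s
  have X: "entry X t s = 0" if "wt k l t - wt k l s \<noteq> \<mu>" for t
    using arg_cong [OF assms, of "\<lambda>Y. entry Y t s"] that by simp
  have "(if wt k l r - wt k l t = \<nu> - \<mu> then entry M r t else 0) * entry X t s
      = (if wt k l r - wt k l s = \<nu> then entry M r t * entry X t s else 0)" for t
    by (cases "wt k l t - wt k l s = \<mu>") (auto simp: X)
  then show "entry (weight_part k l \<nu> (M * X)) r s = entry (weight_part k l (\<nu> - \<mu>) M * X) r s"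
    by (simp add: entry_mult)
qed

section \<open>An edge containing two opposite root spaces\<close>

context
  fixes S :: "'n::finite qmat set" and k l :: 'n
  assumes S: "\<And>x y. x \<in> S \<Longrightarrow> y \<in> S \<Longrightarrow> x * y \<in> S"
    and kl: "k \<noteq> l"
    and root: "\<And>x. qunit k l x \<in> lie_edge S" "\<And>x. qunit l k x \<in> lie_edge S"
begin

lemma subspace_edge: "subspace (lie_edge S)"
  using subspace_lie_edge [OF S] root(1) [of 0] lie_edge_subset by blast

lemma weight_element_in_edge: "qdiag (\<lambda>r. wt k l r *\<^sub>R 1) \<in> lie_edge S"
proof -
  have "qunit k l 1 * qunit l k 1 - qunit l k 1 * qunit k l 1 \<in> lie_edge S"
    by (intro lie_edge_bracket S root)
  moreover have "qunit k l 1 * qunit l k 1 - qunit l k 1 * qunit k l 1 = qdiag (\<lambda>r. wt k l r *\<^sub>R 1)"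
    using kl by (intro qmat_eqI) (auto simp: qunit_mult wt_def)
  ultimately show ?thesis by simp
qed

text \<open>The exponential of this element changes the sign of the coordinates \<open>k\<close> and \<open>l\<close>. The element arises as a
  multiple of the bracket of the corner matrices with entries \<open>qj\<close> and \<open>qk\<close>, because \<open>qj * qk = qi = - (qk * qj)\<close>.\<close>

lemma corner_rotation_in_edge: "qdiag (\<lambda>r. if r = k \<or> r = l then Quat 0 pi 0 0 else 0) \<in> lie_edge S"
proof -
  have "pi *\<^sub>R (qunit k l qj * qunit l k qk - qunit l k qk * qunit k l qj) \<in> lie_edge S"
    by (intro subspace_scale [OF subspace_edge] lie_edge_bracket S root)
  moreover have "pi *\<^sub>R (qunit k l qj * qunit l k qk - qunit l k qk * qunit k l qj) =
      qdiag (\<lambda>r. if r = k \<or> r = l then Quat 0 pi 0 0 else 0)"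
    using kl by (intro qmat_eqI) (auto simp: qunit_mult quat_eq_iff qj_def qk_def)
  ultimately show ?thesis by simp
qed

text \<open>Once the part of weight \<open>2\<close>, which lies in the edge, is removed, \<open>1\<close> is the largest weight, and conjugation
  by \<open>exp (t (E\<^sub>k\<^sub>k - E\<^sub>l\<^sub>l))\<close>, rescaled by \<open>exp (- t)\<close>, converges to the part of weight \<open>1\<close>. The
  entries of that part connect \<open>k\<close> or \<open>l\<close> with another index, so that the sign change of
  \<open>corner_rotation_in_edge\<close> maps it to its negative.\<close>

lemma weight_one_part_in_edge:
  assumes Y: "Y \<in> lie_saturate S"
  shows "weight_part k l 1 Y \<in> lie_edge S"
proof -
  let ?H = "qdiag (\<lambda>r. wt k l r *\<^sub>R 1) :: 'n qmat"
  \<comment> \<open>\<open>Y\<close> without its part of weight \<open>2\<close>.\<close>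
  define Z where "Z = Y + qunit k l (- entry Y k l)"
  have Z: "Z \<in> lie_saturate S"
    unfolding Z_def using Y root(1) lie_edge_subset by (intro lie_saturate_add S) auto
  have entryZ: "entry Z r s = (if r = k \<and> s = l then 0 else entry Y r s)" for r s
    by (simp add: Z_def)
  have conj: "exp (- t) *\<^sub>R (exp (t *\<^sub>R ?H) * Z * exp (t *\<^sub>R (- ?H))) \<in> lie_saturate S" for t
    using lie_saturate_conjugate [OF S Z, of "t *\<^sub>R ?H"]
      subspace_scale [OF subspace_edge weight_element_in_edge, of t]
    by (intro lie_saturate_scale) auto
  have entry_conj: "entry (exp (- t) *\<^sub>R (exp (t *\<^sub>R ?H) * Z * exp (t *\<^sub>R (- ?H)))) r s
      = exp (t * (wt k l r - wt k l s - 1)) *\<^sub>R entry Z r s" for t r s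
  proof -
    have e: "exp (c *\<^sub>R 1 :: quat) = exp c *\<^sub>R 1" for c
      using exp_of_real [of c, where 'a = quat] by (simp add: of_real_def)
    have "exp (- (c *\<^sub>R 1) :: quat) = exp (- c) *\<^sub>R 1" for c
      using e [of "- c"] by simp
    with e have "entry (exp (- t) *\<^sub>R (exp (t *\<^sub>R ?H) * Z * exp (t *\<^sub>R (- ?H)))) r s
        = (exp (- t) * exp (t * wt k l r) * exp (- t * wt k l s)) *\<^sub>R entry Z r s"
      unfolding entry_scaleR entry_conjugate_exp_qdiag by simp
    then show ?thesis by (simp add: algebra_simps flip: exp_add)
  qed
  have "(\<lambda>n. exp (- real n) *\<^sub>R (exp (real n *\<^sub>R ?H) * Z * exp (real n *\<^sub>R (- ?H)))) \<longlonglongrightarrow> weight_part k l 1 Y"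
  proof (rule tendsto_qmatI, unfold entry_conj)
    fix r s
    define c where "c = wt k l r - wt k l s - 1"
    have "r = k \<and> s = l \<or> c = 0 \<or> c < 0"
      using kl by (auto simp: wt_def c_def)
    then consider "r = k \<and> s = l" | "c = 0" | "c < 0" by blast
    then show "(\<lambda>n. exp (real n * (wt k l r - wt k l s - 1)) *\<^sub>R entry Z r s) \<longlonglongrightarrow> entry (weight_part k l 1 Y) r s"
    proof cases
      case 1
      then show ?thesis using kl by (simp add: entryZ wt_def)
    next
      case 2
      then have "\<not> (r = k \<and> s = l)" using kl by (auto simp: wt_def c_def)
      then show ?thesis using 2 by (auto simp: entryZ c_def)
    next
      case 3
      then have "filterlim (\<lambda>n. c * real n) at_bot sequentially"
        by (intro filterlim_tendsto_neg_mult_at_bot [OF tendsto_const] filterlim_real_sequentially)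
      then have "(\<lambda>n. exp (c * real n)) \<longlonglongrightarrow> 0"
        by (rule filterlim_compose [OF exp_at_bot])
      then have "(\<lambda>n. exp (c * real n) *\<^sub>R entry Z r s) \<longlonglongrightarrow> 0 *\<^sub>R entry Z r s"
        by (intro tendsto_scaleR tendsto_const)
      then show ?thesis using 3 by (simp add: c_def mult.commute)
    qed
  qed
  then have W: "weight_part k l 1 Y \<in> lie_saturate S"
    by (rule closed_sequentially [OF closed_lie_saturate conj])
  let ?U = "qdiag (\<lambda>r. if r = k \<or> r = l then Quat 0 pi 0 0 else 0) :: 'n qmat"
  have "exp ?U * weight_part k l 1 Y * exp (- ?U) = - weight_part k l 1 Y"
  proof (rule qmat_eqI)
    fix r s
    have minus_one: "Quat (- 1) 0 0 0 = - 1" by (simp add: quat_eq_iff)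
    have U: "- ?U = qdiag (\<lambda>r. if r = k \<or> r = l then Quat 0 (- pi) 0 0 else 0)"
      by (intro qmat_eqI) (auto simp: quat_eq_iff)
    show "entry (exp ?U * weight_part k l 1 Y * exp (- ?U)) r s = entry (- weight_part k l 1 Y) r s"
      unfolding U exp_qdiag using kl by (auto simp: exp_complex_quat wt_def minus_one)
  qed
  then have "- weight_part k l 1 Y \<in> lie_saturate S"
    using lie_saturate_conjugate [OF S W corner_rotation_in_edge] by simp
  with W show ?thesis by (simp add: lie_edge_def)
qed

text \<open>The derivative at \<open>s = 0\<close> of the weight-one parts of \<open>exp (s X) Y exp (- s X)\<close>, all of which lie in the edge. This
  applies in particular to \<open>Y = A\<close>.\<close>

lemma bracket_weight_one_in_edge:
  assumes X: "X \<in> lie_edge S" and Y: "Y \<in> lie_saturate S"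
  shows "weight_part k l 1 (Y * X - X * Y) \<in> lie_edge S"
proof -
  have "weight_part k l 1 (X * Y - Y * X) \<in> lie_edge S"
  proof (rule derivative_in_closed_subspace [OF closed_lie_edge subspace_edge])
    show "((\<lambda>s. weight_part k l 1 (exp (s *\<^sub>R X) * Y * exp (s *\<^sub>R (- X)))) has_vector_derivative
        weight_part k l 1 (X * Y - Y * X)) (at 0)"
      by (intro bounded_linear.has_vector_derivative [OF bounded_linear_weight_part] exp_conjugation_derivative)
    show "weight_part k l 1 (exp (s *\<^sub>R X) * Y * exp (s *\<^sub>R (- X))) \<in> lie_edge S" for s
      using lie_saturate_conjugate [OF S Y, of "s *\<^sub>R X"] subspace_scale [OF subspace_edge X, of s]
      by (intro weight_one_part_in_edge) simp
  qed
  moreover have "weight_part k l 1 (Y * X - X * Y) = - weight_part k l 1 (X * Y - Y * X)"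
    by (rule qmat_eqI) auto
  ultimately show ?thesis
    using subspace_neg [OF subspace_edge] by simp
qed

end

definition lie_closed :: "'n::finite qmat set \<Rightarrow> bool" where
  "lie_closed L \<longleftrightarrow> subspace L \<and> (\<forall>X\<in>L. \<forall>Y\<in>L. X * Y - Y * X \<in> L)"

lemma lie_closed_hull: "lie_closed (lie_closed hull G)"
  by (rule hull_in) (auto simp: lie_closed_def intro: subspace_Inter)

text \<open>The Jacobi identity.\<close>

lemma lie_closed_normaliser:
  assumes K: "subspace K"
  shows "lie_closed {Y. \<forall>X\<in>K. Y * X - X * Y \<in> K}"
  unfolding lie_closed_def
proof (intro conjI ballI)
  show "subspace {Y. \<forall>X\<in>K. Y * X - X * Y \<in> K}"
    unfolding subspace_def
  proof (intro conjI ballI allI)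
    show "0 \<in> {Y. \<forall>X\<in>K. Y * X - X * Y \<in> K}"
      using subspace_0 [OF K] by simp
    fix Y assume Y: "Y \<in> {Y. \<forall>X\<in>K. Y * X - X * Y \<in> K}"
    show "c *\<^sub>R Y \<in> {Y. \<forall>X\<in>K. Y * X - X * Y \<in> K}" for c
      using Y subspace_scale [OF K, of _ c] by (simp flip: scaleR_diff_right)
    fix Y' assume Y': "Y' \<in> {Y. \<forall>X\<in>K. Y * X - X * Y \<in> K}"
    have "(Y + Y') * X - X * (Y + Y') = (Y * X - X * Y) + (Y' * X - X * Y')" for X
      by (simp add: algebra_simps)
    then show "Y + Y' \<in> {Y. \<forall>X\<in>K. Y * X - X * Y \<in> K}"
      using Y Y' subspace_add [OF K] by simp
  qed
  fix Y Y' assume Y: "Y \<in> {Y. \<forall>X\<in>K. Y * X - X * Y \<in> K}" "Y' \<in> {Y. \<forall>X\<in>K. Y * X - X * Y \<in> K}"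
  have "(Y * Y' - Y' * Y) * X - X * (Y * Y' - Y' * Y)
      = (Y * (Y' * X - X * Y') - (Y' * X - X * Y') * Y) - (Y' * (Y * X - X * Y) - (Y * X - X * Y) * Y')" for X
    by (simp add: algebra_simps)
  then show "Y * Y' - Y' * Y \<in> {Y. \<forall>X\<in>K. Y * X - X * Y \<in> K}"
    using Y subspace_diff [OF K] by simp
qed

text \<open>The bracket with \<open>Z\<close> is a derivation, so it suffices to check generators.\<close>

lemma bracket_preserves_hull:
  assumes G: "\<And>X. X \<in> G \<Longrightarrow> Z * X - X * Z \<in> lie_closed hull G" and X: "X \<in> lie_closed hull G"
  shows "Z * X - X * Z \<in> lie_closed hull G"
proof -
  define K where "K = lie_closed hull G"
  have K: "subspace K" "\<And>X Y. X \<in> K \<Longrightarrow> Y \<in> K \<Longrightarrow> X * Y - Y * X \<in> K"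
    using lie_closed_hull [of G] unfolding K_def [symmetric] by (auto simp: lie_closed_def)
  let ?P = "{X. X \<in> K \<and> Z * X - X * Z \<in> K}"
  have "lie_closed ?P"
    unfolding lie_closed_def
  proof (intro conjI ballI)
    show "subspace ?P"
      unfolding subspace_def
    proof (intro conjI ballI allI)
      show "0 \<in> ?P" using subspace_0 [OF K(1)] by simp
      fix X assume X: "X \<in> ?P"
      show "c *\<^sub>R X \<in> ?P" for c
        using X subspace_scale [OF K(1), of _ c] by (simp flip: scaleR_diff_right)
      fix X' assume X': "X' \<in> ?P"
      have "Z * (X + X') - (X + X') * Z = (Z * X - X * Z) + (Z * X' - X' * Z)"
        by (simp add: algebra_simps)
      then show "X + X' \<in> ?P" using X X' subspace_add [OF K(1)] by simp
    qed
    fix X X' assume X: "X \<in> ?P" "X' \<in> ?P"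
    have "Z * (X * X' - X' * X) - (X * X' - X' * X) * Z
        = ((Z * X - X * Z) * X' - X' * (Z * X - X * Z)) + (X * (Z * X' - X' * Z) - (Z * X' - X' * Z) * X)"
      by (simp add: algebra_simps)
    then show "X * X' - X' * X \<in> ?P"
      using X subspace_add [OF K(1)] K(2) by simp
  qed
  moreover have "G \<subseteq> ?P"
    using G hull_inc [of _ G lie_closed] unfolding K_def by auto
  ultimately have "K \<subseteq> ?P"
    unfolding K_def by (rule hull_minimal [rotated])
  then show ?thesis using X unfolding K_def by auto
qed

definition root_elements :: "'n::finite qmat set \<Rightarrow> 'n \<Rightarrow> 'n \<Rightarrow> 'n qmat set" where
  "root_elements S k l = {X \<in> lie_edge S. \<exists>\<mu>\<in>{-2, -1, 1, 2}. weight_part k l \<mu> X = X}"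

text \<open>The components of \<open>[Z, X]\<close> of weight \<open>\<plusminus>2\<close> are corner matrices, and those of weight \<open>\<plusminus>1\<close> lie in the edge by
  \<open>bracket_weight_one_in_edge\<close>. If \<open>X\<close> has weight \<open>\<mu>\<close>, then the component of weight \<open>0\<close> is the bracket of \<open>X\<close> with the
  component of \<open>Z\<close> of weight \<open>- \<mu>\<close>, which is itself a root element since \<open>\<mu> \<noteq> 0\<close>. Thus the component of
  \<open>Z\<close> of weight \<open>0\<close>, about which nothing is known, never has to lie in the edge.\<close>

lemma bracket_with_root_elements:
  fixes S :: "'n::finite qmat set"
  assumes S: "\<And>x y. x \<in> S \<Longrightarrow> y \<in> S \<Longrightarrow> x * y \<in> S"
    and kl: "k \<noteq> l"
    and root: "\<And>x. qunit k l x \<in> lie_edge S" "\<And>x. qunit l k x \<in> lie_edge S"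
    and Z: "Z \<in> lie_saturate S" and X: "X \<in> root_elements S k l"
  shows "Z * X - X * Z \<in> lie_closed hull root_elements S k l"
proof -
  let ?K = "lie_closed hull root_elements S k l"
  have K: "subspace ?K" "\<And>X Y. X \<in> ?K \<Longrightarrow> Y \<in> ?K \<Longrightarrow> X * Y - Y * X \<in> ?K"
    using lie_closed_hull [of "root_elements S k l"] by (auto simp: lie_closed_def)
  obtain \<mu> where lam: "\<mu> \<in> {-2, -1, 1, 2}" "weight_part k l \<mu> X = X" and XE: "X \<in> lie_edge S"
    using X by (auto simp: root_elements_def)
  have in_K: "weight_part k l \<nu> Y \<in> ?K" if "weight_part k l \<nu> Y \<in> lie_edge S" "\<nu> \<in> {-2, -1, 1, 2}" for \<nu> Y
    by (rule hull_inc) (use that weight_part_idem in \<open>auto simp: root_elements_def\<close>)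
  have two: "weight_part k l \<nu> Y \<in> ?K" if "\<nu> = 2 \<or> \<nu> = -2" for \<nu> Y
    using that weight_part_2 [OF kl, of Y] weight_part_2 [of l k Y] weight_part_swap [OF kl, of 2 Y] kl root
    by (intro in_K) auto
  have Zpart: "weight_part k l \<nu> Z \<in> ?K" if "\<nu> = 1 \<or> \<nu> = -1" for \<nu>
    using that weight_one_part_in_edge [OF S kl root Z] weight_one_part_in_edge [OF S kl [symmetric] root(2,1) Z]
      weight_part_swap [OF kl, of 1 Z]
    by (intro in_K) auto
  define V where "V = Z * X - X * Z"
  have one: "weight_part k l \<nu> V \<in> ?K" if "\<nu> = 1 \<or> \<nu> = -1" for \<nu>
    using that bracket_weight_one_in_edge [OF S kl root XE Z] bracket_weight_one_in_edge [OF S kl [symmetric] root(2,1) XE Z]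
      weight_part_swap [OF kl, of 1 V]
    unfolding V_def by (intro in_K) auto
  have zero: "weight_part k l 0 V \<in> ?K"
  proof -
    have "weight_part k l 0 V = weight_part k l (- \<mu>) Z * X - X * weight_part k l (- \<mu>) Z"
      unfolding V_def linear_diff [OF linear_weight_part] weight_part_mult_left [OF lam(2)]
        weight_part_mult_right [OF lam(2)] by simp
    moreover have "weight_part k l (- \<mu>) Z \<in> ?K"
      using lam(1) two [of "- \<mu>" Z] Zpart [of "- \<mu>"] by auto
    moreover have "X \<in> ?K" using X by (rule hull_inc)
    ultimately show ?thesis using K(2) by simp
  qed
  have "V \<in> ?K"
    by (subst weight_decomposition [of V k l]) (intro subspace_add [OF K(1)] two one zero; simp)
  then show ?thesis by (simp add: V_def)
qed

section \<open>Ideals of the special linear Lie algebra\<close>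

text \<open>Brackets with matrix units move the position of a corner matrix to any off-diagonal place. Brackets of opposite
  positions then give the differences of diagonal matrix units, and, since commutators of quaternions span the
  imaginary quaternions, also \<open>E\<^sub>k\<^sub>k w\<close> for imaginary \<open>w\<close>.\<close>

lemma ideal_is_everything:
  fixes K :: "'n::finite qmat set"
  assumes K: "subspace K" and ideal: "\<And>X Y. rtrace Y = 0 \<Longrightarrow> X \<in> K \<Longrightarrow> Y * X - X * Y \<in> K"
    and kl: "k \<noteq> l" and root: "\<And>x. qunit k l x \<in> K" "\<And>x. qunit l k x \<in> K"
    and X: "rtrace X = 0"
  shows "X \<in> K"
proof -
  have tr: "rtrace (qunit r s x) = 0" if "r \<noteq> s" for r s and x :: quat
    using that by (auto simp: rtrace_eq_sum intro!: sum.neutral)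
  \<comment> \<open>\<open>[E\<^sub>t\<^sub>r, E\<^sub>r\<^sub>s x] = E\<^sub>t\<^sub>s x\<close> and \<open>[E\<^sub>r\<^sub>s x, E\<^sub>s\<^sub>t] = E\<^sub>r\<^sub>t x\<close>.\<close>
  have row: "qunit t s x \<in> K" if "qunit r s x \<in> K" "r \<noteq> s" "t \<noteq> r" "t \<noteq> s" for r s t x
    using ideal [OF tr that(1), of t r 1] that by (simp add: qunit_mult)
  have col: "qunit r t x \<in> K" if "qunit r s x \<in> K" "r \<noteq> s" "t \<noteq> r" "t \<noteq> s" for r s t x
    using subspace_neg [OF K ideal [OF tr that(1), of s t 1]] that by (simp add: qunit_mult)
  have off: "qunit r s x \<in> K" if "r \<noteq> s" for r s x
  proof (cases "r = l")
    case True
    then show ?thesis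
      using col [OF root(2), of s x] root(2) that kl by (cases "s = k") auto
  next
    case False
    have "qunit r l x \<in> K"
      using row [OF root(1), of r x] root(1) False kl by (cases "r = k") auto
    then show ?thesis
      using col [of r l x s] that False by (cases "s = l") auto
  qed
  have diag: "qunit r r x - qunit k k x \<in> K" for r x
  proof (cases "r = k")
    case True
    then show ?thesis using subspace_0 [OF K] by simp
  next
    case False
    then show ?thesis
      using ideal [OF tr off, of r k k r 1 x] by (simp add: qunit_mult)
  qed
  have unit: "qunit k k u \<in> K" if "u = x * y" "y * x = - u" for u x y
  proof -
    have "qunit k l x * qunit l k y - qunit l k y * qunit k l x \<in> K"
      by (intro ideal tr kl root)
    then have "qunit k k u + qunit l l u \<in> K"
      using that by (simp add: qunit_mult qunit_minus)
    then have "(1 / 2) *\<^sub>R ((qunit k k u + qunit l l u) - (qunit l l u - qunit k k u)) \<in> K"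
      by (intro subspace_scale [OF K] subspace_diff [OF K] diag)
    moreover have "(1 / 2) *\<^sub>R ((qunit k k u + qunit l l u) - (qunit l l u - qunit k k u)) = qunit k k u"
      by (rule qmat_eqI) auto
    ultimately show ?thesis by simp
  qed
  have imag: "qunit k k w \<in> K" if "qre w = 0" for w
  proof -
    have "qunit k k qi \<in> K" "qunit k k qj \<in> K" "qunit k k qk \<in> K"
      by (rule unit [of _ qj qk], simp_all add: quat_eq_iff qi_def qj_def qk_def)
        (rule unit [of _ qk qi], simp_all add: quat_eq_iff qi_def qj_def qk_def,
         rule unit [of _ qi qj], simp_all add: quat_eq_iff qi_def qj_def qk_def)
    then have "qim1 w *\<^sub>R qunit k k qi + qim2 w *\<^sub>R qunit k k qj + qim3 w *\<^sub>R qunit k k qk \<in> K"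
      by (intro subspace_add [OF K] subspace_scale [OF K])
    moreover have "w = qim1 w *\<^sub>R qi + qim2 w *\<^sub>R qj + qim3 w *\<^sub>R qk"
      using that by (simp add: quat_eq_iff qi_def qj_def qk_def)
    ultimately show ?thesis
      by (metis qunit_add qunit_scale)
  qed
  define w where "w = (\<Sum>r\<in>UNIV. entry X r r)"
  \<comment> \<open>All diagonal entries are moved to the place \<open>k\<close>, where they add up to an imaginary quaternion.\<close>
  define D where "D = (\<lambda>r s. if r = s then qunit r r (entry X r r) - qunit k k (entry X r r) else qunit r s (entry X r s))"
  have "(\<Sum>r\<in>UNIV. \<Sum>s\<in>UNIV. D r s) + qunit k k w \<in> K"
  proof (intro subspace_add [OF K] subspace_sum [OF K] imag)
    show "D r s \<in> K" for r s
      unfolding D_def using diag off by simp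
    have "qre w = rtrace X"
      by (simp add: w_def rtrace_eq_sum qre_sum)
    then show "qre w = 0" using X by simp
  qed
  moreover have "X = (\<Sum>r\<in>UNIV. \<Sum>s\<in>UNIV. D r s) + qunit k k w"
  proof -
    have "D r s = qunit r s (entry X r s) - (if r = s then qunit k k (entry X r r) else 0)" for r s
      by (simp add: D_def)
    then have "(\<Sum>r\<in>UNIV. \<Sum>s\<in>UNIV. D r s) = (\<Sum>r\<in>UNIV. \<Sum>s\<in>UNIV. qunit r s (entry X r s)) - (\<Sum>r\<in>UNIV. qunit k k (entry X r r))"
      by (simp add: sum_subtractf)
    moreover have "(\<Sum>r\<in>UNIV. qunit k k (entry X r r)) = qunit k k w"
      by (rule qmat_eqI) (auto simp: w_def)
    moreover have "(\<Sum>r\<in>UNIV. \<Sum>s\<in>UNIV. qunit r s (entry X r s)) = X"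
    proof (rule qmat_eqI)
      fix a b
      have "(\<Sum>r\<in>UNIV. \<Sum>s\<in>UNIV. if a = r \<and> b = s then entry X r s else 0) = (\<Sum>r\<in>UNIV. if a = r then entry X a b else 0)"
        by (rule sum.cong) (auto simp: sum.delta)
      then show "entry (\<Sum>r\<in>UNIV. \<Sum>s\<in>UNIV. qunit r s (entry X r s)) a b = entry X a b"
        by simp
    qed
    ultimately show ?thesis by simp
  qed
  ultimately show ?thesis by simp
qed

section \<open>Controllability\<close>

lemma sqnorms_nonzero:
  assumes "x \<notin> span {1, qi} \<union> span {qj, qk}"
  shows "sqnorm_1i x \<noteq> 0" "sqnorm_jk x \<noteq> 0"
proof -
  have x: "x = (qre x *\<^sub>R 1 + qim1 x *\<^sub>R qi) + (qim2 x *\<^sub>R qj + qim3 x *\<^sub>R qk)"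
    by (simp add: quat_eq_iff qi_def qj_def qk_def)
  have s1: "qre x *\<^sub>R 1 + qim1 x *\<^sub>R qi \<in> span {1, qi}" and s2: "qim2 x *\<^sub>R qj + qim3 x *\<^sub>R qk \<in> span {qj, qk}"
    by (intro span_add span_scale span_base; simp)+
  show "sqnorm_1i x \<noteq> 0"
  proof
    assume "sqnorm_1i x = 0"
    then have "qre x = 0" "qim1 x = 0" by (simp_all add: sqnorm_1i_def sum_power2_eq_zero_iff)
    then show False using x s2 assms by simp
  qed
  show "sqnorm_jk x \<noteq> 0"
  proof
    assume "sqnorm_jk x = 0"
    then have "qim2 x = 0" "qim3 x = 0" by (simp_all add: sqnorm_jk_def sum_power2_eq_zero_iff)
    then show False using x s1 assms by simp
  qed
qed

text \<open>The map \<open>\<rho> \<mapsto> (\<rho> + 1) / (\<rho> - 1)\<close> is its own inverse and preserves rationality.\<close>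

lemma Rats_cayley:
  fixes x y :: real
  assumes "y \<noteq> 0" "x / y \<notin> \<rat>"
  shows "x - y \<noteq> 0" "x + y \<noteq> 0" "(x + y) / (x - y) \<notin> \<rat>"
proof -
  show d: "x - y \<noteq> 0" using assms by auto
  have "x = - y \<Longrightarrow> x / y = -1" using assms(1) by simp
  then show "x + y \<noteq> 0" using assms(2) by fastforce
  show "(x + y) / (x - y) \<notin> \<rat>"
  proof
    define c where "c = (x + y) / (x - y)"
    assume "(x + y) / (x - y) \<in> \<rat>"
    then have c: "c \<in> \<rat>" by (simp add: c_def)
    have e: "c * (x - y) = x + y" using d by (simp add: c_def)
    then have "c \<noteq> 1" using assms(1) by auto
    moreover have "x * (c - 1) = y * (c + 1)" using e by (simp add: algebra_simps)
    ultimately have "x / y = (c + 1) / (c - 1)" using assms(1) by (simp add: field_simps)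
    then show False using assms(2) c by simp
  qed
qed

text \<open>Both inclusions pass through the group generated by the exponentials of \<open>sl(n, H)\<close>: it contains \<open>S\<close> because the
  generators of \<open>S\<close> have trace zero, and it is contained in \<open>S\<close> by \<open>semigroup_contains_exponentials\<close>.\<close>

lemma controllable_if_edge_full:
  fixes A B :: "quat^'n^'n"
  assumes A: "A \<in> sl" and B: "B \<in> sl"
    and edge: "\<And>X. rtrace X = 0 \<Longrightarrow> X \<in> lie_edge {M. mat_of M \<in> control_semigroup A B}"
  shows "controllable A B"
proof -
  let ?S = "{M. mat_of M \<in> control_semigroup A B}"
  have S: "x * y \<in> ?S" if "x \<in> ?S" "y \<in> ?S" for x y
    using that by (simp add: times_qmat.rep_eq control_semigroup.product)
  have tr: "rtrace (qmat (t *\<^sub>R (A + u *\<^sub>R B))) = 0" for t u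
  proof -
    have "rtrace (qmat A) = 0" "rtrace (qmat B) = 0"
      using A B by (simp_all add: sl_def rtrace_def qmat_inverse)
    moreover have "rtrace (qmat (t *\<^sub>R (A + u *\<^sub>R B))) = t * (rtrace (qmat A) + u * rtrace (qmat B))"
      by (simp only: linear_simps(1,5) [OF bounded_linear_qmat] linear_add [OF linear_rtrace]
          linear_scale [OF linear_rtrace] real_scaleR_def)
    ultimately show ?thesis by simp
  qed
  have sub: "qmat g \<in> exp_group" if "g \<in> control_semigroup A B" for g
    using that
  proof (induction g rule: control_semigroup.induct)
    case (generator t u)
    then show ?case
      by (simp add: mexp_eq_exp mat_of_inverse exp_group_exp tr)
  next
    case (product g h)
    have "qmat (g ** h) = qmat g * qmat h"
      by (simp add: times_qmat.abs_eq eq_onp_same_args)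
    then show ?case using product.IH exp_group_mult by simp
  qed
  have "control_semigroup A B \<subseteq> SL"
  proof
    fix g assume g: "g \<in> control_semigroup A B"
    then obtain h where h: "h * qmat g = 1" "qmat g * h = 1"
      using exp_group_inverse [OF sub] by blast
    have "mat_of h ** g = mat 1" "g ** mat_of h = mat 1"
      using arg_cong [OF h(1), of mat_of] arg_cong [OF h(2), of mat_of]
      by (simp_all add: times_qmat.rep_eq one_qmat.rep_eq qmat_inverse)
    then have "invertible g" unfolding invertible_def by blast
    moreover have "det (real_matrix g) = 1"
      using sdet_exp_group [OF sub [OF g]] by (simp add: sdet_def qmat_inverse)
    ultimately show "g \<in> SL" by (simp add: SL_def)
  qed
  moreover have "SL \<subseteq> control_semigroup A B"
  proof
    fix g :: "quat^'n^'n" assume g: "g \<in> SL"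
    then obtain h where h: "h ** g = mat 1"
      by (auto simp: SL_def invertible_def)
    have "qmat h * qmat g = 1"
      using h by (simp add: times_qmat.abs_eq one_qmat.abs_eq eq_onp_same_args)
    moreover have "sdet (qmat g) = 1"
      using g by (simp add: sdet_def SL_def qmat_inverse)
    ultimately have "qmat g \<in> exp_group"
      by (rule special_linear_subset_exp_group)
    moreover have "exp_group \<subseteq> ?S"
    proof (rule exp_group_subset [OF S])
      show "exp X \<in> ?S" if "rtrace X = 0" for X
      proof (rule semigroup_contains_exponentials [OF S _ edge that])
        show "sdet x = 1" if "x \<in> ?S" for x
          using sdet_exp_group [OF sub, of "mat_of x"] that by (simp add: mat_of_inverse)
      qed
    qed
    ultimately show "g \<in> control_semigroup A B"
      by (auto simp: qmat_inverse)
  qed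
  ultimately show ?thesis
    by (simp add: controllable_def)
qed

theorem theorem4p1:
  fixes A B :: "quat^'n^'n" and n :: nat and ix :: "nat \<Rightarrow> 'n" and a b :: "nat \<Rightarrow> real"
  assumes n: "n = CARD('n)"
    and ix: "bij_betw ix {1..n} UNIV"
    and A: "A \<in> sl" and B: "B \<in> sl"
    and generates: "generated_lie_algebra {A, B} = sl"
    and diag: "\<forall>r\<in>{1..n}. \<forall>s\<in>{1..n}. B $ ix r $ ix s = (if r = s then a r *\<^sub>R 1 + b r *\<^sub>R qi else 0)"
    and a_first: "a 1 > a 2"
    and a_mid: "\<forall>r. 2 \<le> r \<and> r + 1 \<le> n - 1 \<longrightarrow> a r \<ge> a (r + 1)"
    and a_last: "a (n - 1) > a n"
    and b_nz: "b 1 \<noteq> 0" "b n \<noteq> 0"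
    and b_irrational: "b 1 / b n \<notin> \<rat>"
    and p: "A $ ix 1 $ ix n \<notin> span {1, qi} \<union> span {qj, qk}"
    and q: "A $ ix n $ ix 1 \<notin> span {1, qi} \<union> span {qj, qk}"
  shows "controllable A B"
proof (rule controllable_if_edge_full [OF A B])
  let ?S = "{M. mat_of M \<in> control_semigroup A B}"
  define S where "S = ?S"
  have S: "x * y \<in> S" if "x \<in> S" "y \<in> S" for x y
    using that by (simp add: S_def times_qmat.rep_eq control_semigroup.product)
  define inx where "inx = inv_into {1..n} ix"
  define k where "k = ix 1"
  define l where "l = ix n"
  define \<alpha> where "\<alpha> = a \<circ> inx"
  define \<beta> where "\<beta> = b \<circ> inx"
  have n1: "n \<ge> 1" using n by (simp add: Suc_leI)
  have inx: "inx r \<in> {1..n}" "ix (inx r) = r" for r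
    using ix inv_into_into [of r ix "{1..n}"] f_inv_into_f [of r ix "{1..n}"]
    by (auto simp: inx_def bij_betw_def)
  have inx_ix: "inx (ix r) = r" if "r \<in> {1..n}" for r
    using ix that by (simp add: inx_def bij_betw_def)
  \<comment> \<open>For \<open>n = 1\<close> the quotient \<open>b 1 / b n\<close> would be \<open>1\<close>.\<close>
  have "n \<noteq> 1" using b_irrational b_nz by auto
  then have n2: "n \<ge> 2" using n1 by simp
  have kl: "k \<noteq> l"
    using inx_ix [of 1] inx_ix [of n] n2 by (auto simp: k_def l_def)
  have B_diag: "qmat B = qdiag (\<lambda>r. Quat (\<alpha> r) (\<beta> r) 0 0)"
  proof (rule qmat_eqI)
    fix r s
    have "B $ ix (inx r) $ ix (inx s) = (if inx r = inx s then a (inx r) *\<^sub>R 1 + b (inx r) *\<^sub>R qi else 0)"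
      using diag inx by blast
    moreover have "inx r = inx s \<longleftrightarrow> r = s" using inx(2) by metis
    moreover have "x *\<^sub>R 1 + y *\<^sub>R qi = Quat x y 0 0" for x y
      by (simp add: quat_eq_iff qi_def)
    moreover have "entry (qmat B) r s = B $ r $ s"
      by (simp add: entry.rep_eq qmat_inverse)
    ultimately show "entry (qmat B) r s = entry (qdiag (\<lambda>r. Quat (\<alpha> r) (\<beta> r) 0 0)) r s"
      by (simp add: inx \<alpha>_def \<beta>_def)
  qed
  have decr: "a r \<ge> a (Suc r)" if "1 \<le> r" "Suc r \<le> n" for r
  proof -
    have "r = 1 \<or> Suc r = n \<or> 2 \<le> r \<and> r + 1 \<le> n - 1" using that by arith
    then show ?thesis
      using a_first a_last a_mid by (auto simp: numeral_2_eq_2)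
  qed
  have mono: "a s \<le> a r" if "1 \<le> r" "r \<le> s" "s \<le> n" for r s
    using that(2,3)
  proof (induction s rule: dec_induct)
    case (step m)
    then show ?case using decr [of m] that(1) by linarith
  qed simp
  have first: "a r < a 1" if "2 \<le> r" "r \<le> n" for r
    using mono [of 2 r] that a_first by simp
  have last: "a n < a r" if "1 \<le> r" "r < n" for r
  proof -
    have "a (n - 1) \<le> a r" using that by (intro mono) auto
    then show ?thesis using a_last by simp
  qed
  have \<alpha>k: "\<alpha> r < \<alpha> k" if "r \<noteq> k" for r
  proof -
    have "inx r \<noteq> 1" using that inx(2) [of r] by (auto simp: k_def)
    then show ?thesis
      using first [of "inx r"] inx(1) [of r] inx_ix [of 1] n1 by (simp add: \<alpha>_def k_def)
  qed
  have \<alpha>l: "\<alpha> l < \<alpha> r" if "r \<noteq> l" for r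
  proof -
    have "inx r \<noteq> n" using that inx(2) [of r] by (auto simp: l_def)
    then show ?thesis
      using last [of "inx r"] inx(1) [of r] inx_ix [of n] n1 by (simp add: \<alpha>_def l_def)
  qed
  have dom: "\<alpha> r - \<alpha> s < \<alpha> k - \<alpha> l" if "(r, s) \<noteq> (k, l)" for r s
    using that \<alpha>k [of r] \<alpha>l [of s] by (cases "r = k"; cases "s = l") auto
  have \<beta>kl: "\<beta> k = b 1" "\<beta> l = b n"
    using inx_ix [of 1] inx_ix [of n] n1 by (simp_all add: \<beta>_def k_def l_def)
  note \<mu> = Rats_cayley [OF b_nz(2) b_irrational, folded \<beta>kl]
  have gen: "qmat A + u *\<^sub>R qmat B \<in> lie_saturate S" for u
  proof (rule lie_saturateI)
    fix t :: real assume "t \<ge> 0"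
    then have "mexp (t *\<^sub>R (A + u *\<^sub>R B)) \<in> control_semigroup A B"
      by (rule control_semigroup.generator)
    then show "exp (t *\<^sub>R (qmat A + u *\<^sub>R qmat B)) \<in> S"
      by (simp add: S_def mexp_eq_exp linear_simps(1,5) [OF bounded_linear_qmat])
  qed
  have A_sat: "qmat A \<in> lie_saturate S" using gen [of 0] by simp
  \<comment> \<open>\<open>A + u B\<close> with \<open>u = m c\<close>, divided by \<open>m\<close>, tends to \<open>c B\<close>; here \<open>c\<close> may be negative.\<close>
  have B_lim: "c *\<^sub>R qmat B \<in> lie_saturate S" for c
  proof (rule closed_sequentially [OF closed_lie_saturate])
    show "inverse (real (Suc m)) *\<^sub>R (qmat A + (real (Suc m) * c) *\<^sub>R qmat B) \<in> lie_saturate S" for m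
      by (intro lie_saturate_scale gen) simp
    have "(\<lambda>m. inverse (real (Suc m)) *\<^sub>R qmat A + c *\<^sub>R qmat B) \<longlonglongrightarrow> 0 *\<^sub>R qmat A + c *\<^sub>R qmat B"
      by (intro tendsto_intros LIMSEQ_inverse_real_of_nat)
    moreover have eq: "inverse (real (Suc m)) * (real (Suc m) * c) = c" for m
      by (simp flip: mult.assoc)
    ultimately show "(\<lambda>m. inverse (real (Suc m)) *\<^sub>R (qmat A + (real (Suc m) * c) *\<^sub>R qmat B)) \<longlonglongrightarrow> c *\<^sub>R qmat B"
      by (simp add: scaleR_add_right eq del: of_nat_Suc)
  qed
  have B_edge: "qmat B \<in> lie_edge S" "- qmat B \<in> lie_edge S"
    using B_lim [of 1] B_lim [of "-1"] by (simp_all add: lie_edge_def)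
  have entryA: "entry (qmat A) r s = A $ r $ s" for r s
    by (simp add: entry.rep_eq qmat_inverse)
  have root_kl: "qunit k l y \<in> lie_edge S" for y
    by (rule extremal_root_space [OF S A_sat B_edge(1) [unfolded B_diag] dom _ _ \<mu>])
      (use sqnorms_nonzero [OF p] in \<open>simp_all add: entryA k_def l_def\<close>)
  \<comment> \<open>For \<open>- B\<close> the dominant growth rate is that of the opposite corner.\<close>
  have root_lk: "qunit l k y \<in> lie_edge S" for y
  proof (rule extremal_root_space [OF S A_sat, where \<alpha> = "\<lambda>r. - \<alpha> r" and \<beta> = "\<lambda>r. - \<beta> r"])
    have "- qmat B = qdiag (\<lambda>r. Quat (- \<alpha> r) (- \<beta> r) 0 0)"
      unfolding B_diag by (intro qmat_eqI) (simp add: quat_eq_iff)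
    then show "qdiag (\<lambda>r. Quat (- \<alpha> r) (- \<beta> r) 0 0) \<in> lie_edge S"
      using B_edge(2) by simp
    show "- \<alpha> r - - \<alpha> s < - \<alpha> l - - \<alpha> k" if "(r, s) \<noteq> (l, k)" for r s
      using dom [of s r] that by auto
    show "sqnorm_1i (entry (qmat A) l k) \<noteq> 0" "sqnorm_jk (entry (qmat A) l k) \<noteq> 0"
      using sqnorms_nonzero [OF q] by (simp_all add: entryA k_def l_def)
    have "- b n / - b 1 \<notin> \<rat>"
      using b_irrational Rats_inverse [of "b n / b 1"] by (auto simp: inverse_eq_divide)
    then show "- \<beta> l - - \<beta> k \<noteq> 0" "- \<beta> l + - \<beta> k \<noteq> 0" "(- \<beta> l + - \<beta> k) / (- \<beta> l - - \<beta> k) \<notin> \<rat>"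
      unfolding \<beta>kl using b_nz(1) by (intro Rats_cayley; simp)+
  qed
  define K where "K = lie_closed hull root_elements S k l"
  have K: "subspace K"
    using lie_closed_hull [of "root_elements S k l"] unfolding K_def [symmetric] by (simp add: lie_closed_def)
  have K_edge: "K \<subseteq> lie_edge S"
    unfolding K_def
  proof (rule hull_minimal)
    show "root_elements S k l \<subseteq> lie_edge S" by (auto simp: root_elements_def)
    show "lie_closed (lie_edge S)"
      unfolding lie_closed_def using A_sat
      by (intro conjI ballI lie_edge_bracket S subspace_lie_edge) auto
  qed
  define N where "N = {Y. \<forall>X\<in>K. Y * X - X * Y \<in> K}"
  have N: "lie_closed N" unfolding N_def by (rule lie_closed_normaliser [OF K])
  have in_N: "Z \<in> N" if "Z \<in> lie_saturate S" for Z
    using bracket_preserves_hull [OF bracket_with_root_elements [OF S kl root_kl root_lk that]]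
    by (simp add: N_def K_def)
  have "generated_lie_algebra {A, B} \<subseteq> {M. qmat M \<in> N}"
    unfolding generated_lie_algebra_def
  proof (rule hull_minimal)
    show "{A, B} \<subseteq> {M. qmat M \<in> N}"
      using in_N A_sat B_edge(1) lie_edge_subset by auto
    have "qmat (lie_bracket X Y) = qmat X * qmat Y - qmat Y * qmat X" for X Y :: "quat^'n^'n"
      by (simp add: lie_bracket_def times_qmat.abs_eq minus_qmat.abs_eq eq_onp_same_args)
    moreover have "subspace {M. qmat M \<in> N}"
      using N linear_subspace_vimage [OF bounded_linear.linear [OF bounded_linear_qmat], of N]
      by (simp add: lie_closed_def vimage_def)
    ultimately show "real_lie_subalgebra {M. qmat M \<in> N}"
      using N by (simp add: real_lie_subalgebra_def lie_closed_def)
  qed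
  then have sl_N: "Y \<in> N" if "rtrace Y = 0" for Y
    using that generates by (auto simp: sl_def rtrace_def mat_of_inverse dest: subsetD [of _ _ "mat_of Y"])
  have root_K: "qunit k l x \<in> K" "qunit l k x \<in> K" for x
  proof -
    have "weight_part k l 2 (qunit k l x) = qunit k l x" "weight_part k l (-2) (qunit l k x) = qunit l k x"
      using kl by (auto intro!: qmat_eqI simp: wt_def)
    then have "qunit k l x \<in> root_elements S k l" "qunit l k x \<in> root_elements S k l"
      using root_kl root_lk by (auto simp: root_elements_def)
    then show "qunit k l x \<in> K" "qunit l k x \<in> K"
      unfolding K_def by (simp_all add: hull_inc)
  qed
  fix X :: "'n qmat" assume "rtrace X = 0"
  then have "X \<in> K"
    using ideal_is_everything [OF K _ kl root_K] sl_N unfolding N_def by simp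
  then show "X \<in> lie_edge ?S"
    using K_edge unfolding S_def by (rule subsetD [rotated])
qed

end
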